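(* Let $X,Y$ be two triangulable spaces, and let $\vec\varphi=(\varphi_1,\dots,\varphi_n):X\to\mathbb{R}^n$, $\vec\psi=(\psi_1,\dots,\psi_n):Y\to\mathbb{R}^n$ be two filtering functions (i.e. continuous functions). Let $\Lambda,B\subseteq\mathbb{R}^n$ and, for $(\vec\lambda,\vec\beta)\in\Lambda\times B$, let $$\pi_{(\vec\lambda,\vec\beta)}=\{(s\vec\lambda+\vec\beta,\;t\vec\lambda+\vec\beta): s,t\in\mathbb{R},\ s<t\}\subseteq\mathbb{R}^n\times\mathbb{R}^n .$$ Assume that the following conditions hold: (i) for every $(\vec u,\vec v)\in\Delta^+$ there exists one and only one $(\vec\lambda,\vec\beta)\in\Lambda\times B$ such that $(\vec u,\vec v)\in\pi_{(\vec\lambda,\vec\beta)}$; (ii) for every $(\vec\lambda,\vec\beta)\in\Lambda\times B$, $\pi_{(\vec\lambda,\vec\beta)}\subseteq\Delta^+$. Set $F^{\vec\varphi}_{(\vec\lambda,\vec\beta)}=\max_{i=1,\dots,n}\frac{\varphi_i-\beta_i}{\lambda_i}:X\to\mathbb{R}$ and $F^{\vec\psi}_{(\vec\lambda,\vec\beta)}=\max_{i=1,\dots,n}\frac{\psi_i-\beta_i}{\lambda_i}:Y\to\mathbb{R}$. Then the distance $\widehat D_{match}$ between multidimensional rank invariants, defined as $$\widehat D_{match}(\rho_{(X,\vec\varphi),k},\rho_{(Y,\vec\psi),k})=\sup_{(\vec\lambda,\vec\beta)\in\Lambda\times B}\Big(\min_{i=1,\dots,n}\lambda_i\Big)\cdot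 d_{match}\Big(\rho_{(X,F^{\vec\varphi}_{(\vec\lambda,\vec\beta)}),k},\rho_{(Y,F^{\vec\psi}_{(\vec\lambda,\vec\beta)}),k}\Big),$$ coincides with the multidimensional matching distance: $$\widehat D_{match}(\rho_{(X,\vec\varphi),k},\rho_{(Y,\vec\psi),k})=D_{match}(\rho_{(X,\vec\varphi),k},\rho_{(Y,\vec\psi),k}).$$
   Context: Conventions. A topological space is triangulable if it is homeomorphic to the underlying space of a finite simplicial complex. $\mathbb{K}$ is a fixed field, $k\in\mathbb{Z}$ is fixed, and $\check H_k$ denotes $k$th Čech homology with coefficients in $\mathbb{K}$. For $\vec u,\vec v\in\mathbb{R}^n$, $\vec u\preceq\vec v$ (resp. $\vec u\prec\vec v$) means $u_i\le v_i$ (resp. $u_i<v_i$) for all $i$. $\Delta^+=\{(\vec u,\vec v)\in\mathbb{R}^n\times\mathbb{R}^n:\vec u\prec\vec v\}$. (Condition (ii) forces $\lambda_i>0$ for all $i$, so the functions $F$ are well defined.) Rank invariant. For a continuous $\vec\varphi:X\to\mathbb{R}^n$ and $\vec u\in\mathbb{R}^n$ put $X\langle\vec\varphi\preceq\vec u\rangle=\{x\in X:\varphi_i(x)\le u_i,\ i=1,\dots,n\}$. The $k$th rank invariant $\rho_{(X,\vec\varphi),k}:\Delta^+\to\mathbb{N}$ sends $(\vec u,\vec v)$ to the dimension of the image of the map $\check H_k(X\langle\vec\varphi\preceq\vec u\rangle)\to\check H_k(X\langle\vec\varphi\preceq\vec v\rangle)$ induced by inclusion (this is known to be finite). For $n=1$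 the arrows are dropped and $\Delta^+=\{(u,v)\in\mathbb{R}^2:u<v\}$. Persistence diagrams (case $n=1$, $\varphi:X\to\mathbb{R}$ continuous). Let $\Delta=\{(u,u):u\in\mathbb{R}\}$, $\Delta^*=\Delta^+\cup\{(u,\infty):u\in\mathbb{R}\}$, $\bar\Delta^*=\Delta^*\cup\Delta$. For $p=(u,v)\in\Delta^+$, the multiplicity $\mu_k(p)$ is the minimum over $\varepsilon>0$ with $u+\varepsilon<v-\varepsilon$ of $$\rho_{(X,\varphi),k}(u+\varepsilon,v-\varepsilon)-\rho_{(X,\varphi),k}(u-\varepsilon,v-\varepsilon)-\rho_{(X,\varphi),k}(u+\varepsilon,v+\varepsilon)+\rho_{(X,\varphi),k}(u-\varepsilon,v+\varepsilon);$$ $p$ is a proper cornerpoint if $\mu_k(p)>0$. For $(\bar u,\infty)$, $\mu_k((\bar u,\infty))$ is the minimum over $\varepsilon>0$ with $\bar u+\varepsilon<1/\varepsilon$ of $\rho_{(X,\varphi),k}(\bar u+\varepsilon,1/\varepsilon)-\rho_{(X,\varphi),k}(\bar u-\varepsilon,1/\varepsilon)$; $(\bar u,\infty)$ is a cornerpoint at infinity if this is positive. The persistence diagram $D_k(X,\varphi)$ is the multiset in $\bar\Delta^*$ of all cornerpoints (proper and at infinity) counted with multiplicity, together with the points of $\Delta$, each counted with infinite multiplicity. Matching distance (case $n=1$). For continuous $\varphi:X\to\mathbb{R}$, $\psi:Y\to\mathbb{R}$, $$d_{match}(\rho_{(X,\varphi),k},\rho_{(Y,\psi),k})=\inf_\gamma\max_{p\in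 D_k(X,\varphi)}\|p-\gamma(p)\|_{\widetilde\infty}\in[0,\infty],$$ where $\gamma$ ranges over all bijections of multisets $D_k(X,\varphi)\to D_k(Y,\psi)$ and for $p=(u,v)$, $q=(u',v')$ in $\bar\Delta^*$ $$\|p-q\|_{\widetilde\infty}=\min\Big\{\max\{|u-u'|,|v-v'|\},\max\big\{\tfrac{v-u}{2},\tfrac{v'-u'}{2}\big\}\Big\},$$ with conventions $\infty-y=y-\infty=\infty$ for $y\ne\infty$, $\infty-\infty=0$, $\frac{\infty}{2}=\infty$, $|\infty|=\infty$, $\min\{c,\infty\}=c$, $\max\{c,\infty\}=\infty$. Multidimensional matching distance. $Adm_n$ is the set of pairs $(\vec l,\vec b)\in\mathbb{R}^n\times\mathbb{R}^n$ with $l_i>0$ for all $i$, $\sum_i l_i^2=1$ and $\sum_i b_i=0$. With $F^{\vec\varphi}_{(\vec l,\vec b)}=\max_i\frac{\varphi_i-b_i}{l_i}$ and $F^{\vec\psi}_{(\vec l,\vec b)}=\max_i\frac{\psi_i-b_i}{l_i}$, $$D_{match}(\rho_{(X,\vec\varphi),k},\rho_{(Y,\vec\psi),k})=\sup_{(\vec l,\vec b)\in Adm_n}\Big(\min_i l_i\Big)\cdot d_{match}\Big(\rho_{(X,F^{\vec\varphi}_{(\vec l,\vec b)}),k},\rho_{(Y,F^{\vec\psi}_{(\vec l,\vec b)}),k}\Big)\in[0,\infty].$$ *)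

theory Defs
  imports "HOL-Analysis.Analysis" "HOL-Library.Poly_Mapping"
begin

section \<open>Triangulable spaces\<close>

text \<open>
  The type argument supplies the Euclidean space in which the finite simplicial complex lives. As
  a hypothesis of a theorem in which \<open>'e\<close> is a type variable, this expresses triangulability by a
  finite complex in a Euclidean space of arbitrary dimension.
\<close>

definition triangulable :: "'e::euclidean_space itself \<Rightarrow> 'a topology \<Rightarrow> bool" where
  "triangulable E X \<longleftrightarrow>
     (\<exists>\<C> :: 'e set set. simplicial_complex \<C> \<and> X homeomorphic_space top_of_set (\<Union>\<C>))"


section \<open>Homology of abstract simplicial complexes over a field\<close>

text \<open>
  An abstract simplicial complex is given by its set \<open>N\<close> of (finite, nonempty) simplices. We use the
  ordered chain complex (unaugmented): the generators in degree \<open>k\<close> are the lists of \<open>k + 1\<close>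
  not necessarily distinct vertices that lie in a common simplex, and coefficients are in the field
  \<open>'f\<close>. All groups vanish for \<open>k < 0\<close>.
\<close>

type_synonym ('v, 'f) chain = "'v list \<Rightarrow>\<^sub>0 'f"

definition chain_scale :: "'f::field \<Rightarrow> ('v, 'f) chain \<Rightarrow> ('v, 'f) chain" where
  "chain_scale a = Poly_Mapping.map ((*) a)"

definition chains :: "int \<Rightarrow> 'v set set \<Rightarrow> ('v, 'f::field) chain set" where
  "chains k N = {c. \<forall>vs \<in> Poly_Mapping.keys c. set vs \<in> N \<and> int (length vs) = k + 1}"

definition chain_boundary :: "('v, 'f::field) chain \<Rightarrow> ('v, 'f) chain" where
  "chain_boundary c =
     (\<Sum>vs \<in> Poly_Mapping.keys c.
        if length vs \<le> 1 then 0
        else \<Sum>i<length vs. Poly_Mapping.single (take i vs @ drop (Suc i) vs)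
                               ((- 1) ^ i * Poly_Mapping.lookup c vs))"

definition cycles :: "int \<Rightarrow> 'v set set \<Rightarrow> ('v, 'f::field) chain set" where
  "cycles k N = {c \<in> chains k N. chain_boundary c = 0}"

definition boundaries :: "int \<Rightarrow> 'v set set \<Rightarrow> ('v, 'f::field) chain set" where
  "boundaries k N = chain_boundary ` chains (k + 1) N"

text \<open>Homology classes are the cosets of the boundaries in the cycles.\<close>

definition homology :: "int \<Rightarrow> 'v set set \<Rightarrow> ('v, 'f::field) chain set set" where
  "homology k N = (\<lambda>z. (+) z ` boundaries k N) ` cycles k N"

definition chain_map :: "('v \<Rightarrow> 'w) \<Rightarrow> ('v, 'f::field) chain \<Rightarrow> ('w, 'f) chain" where
  "chain_map p c =
     (\<Sum>vs \<in> Poly_Mapping.keys c. Poly_Mapping.single (map p vs) (Poly_Mapping.lookup c vs))"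

text \<open>The map into \<open>H\<^sub>k(N')\<close> induced by a simplicial map \<open>p\<close> into \<open>N'\<close>, applied to a class \<open>h\<close>.\<close>

definition homology_map ::
  "int \<Rightarrow> 'w set set \<Rightarrow> ('v \<Rightarrow> 'w) \<Rightarrow> ('v, 'f::field) chain set \<Rightarrow> ('w, 'f) chain set" where
  "homology_map k N' p h = {chain_map p z + b | z b. z \<in> h \<and> b \<in> boundaries k N'}"

text \<open>
  The linear combination of the classes \<open>h i\<close> (\<open>i \<in> I\<close>) with coefficients \<open>a i\<close> in
  \<open>H\<^sub>k(N)\<close>; the zero class is \<open>boundaries k N\<close>.
\<close>

definition homology_lincomb ::
  "int \<Rightarrow> 'v set set \<Rightarrow> 'i set \<Rightarrow> ('i \<Rightarrow> 'f::field) \<Rightarrow> ('i \<Rightarrow> ('v, 'f) chain set) \<Rightarrow> ('v, 'f) chain set"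
where
  "homology_lincomb k N I a h =
     {(\<Sum>i\<in>I. chain_scale (a i) (z i)) + b | z b. (\<forall>i\<in>I. z i \<in> h i) \<and> b \<in> boundaries k N}"


section \<open>Cech homology\<close>

definition open_covers :: "'a topology \<Rightarrow> 'a set set set" where
  "open_covers X = {\<U>. (\<forall>U\<in>\<U>. openin X U) \<and> \<Union>\<U> = topspace X}"

definition nerve :: "'a set set \<Rightarrow> 'a set set set" where
  "nerve \<U> = {\<sigma>. \<sigma> \<subseteq> \<U> \<and> finite \<sigma> \<and> \<sigma> \<noteq> {} \<and> \<Inter>\<sigma> \<noteq> {}}"

definition refinement_projection :: "'a set set \<Rightarrow> 'a set set \<Rightarrow> ('a set \<Rightarrow> 'a set) \<Rightarrow> bool" where
  "refinement_projection \<U> \<V> p \<longleftrightarrow> (\<forall>U\<in>\<U>. p U \<in> \<V> \<and> U \<subseteq> p U)"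

type_synonym ('a, 'f) thread = "'a set set \<Rightarrow> ('a set, 'f) chain set"

text \<open>
  The inverse limit, over all open covers ordered by refinement, of the homology of the nerves: an
  element is a family of classes, one for each cover, compatible with the maps induced by
  the refinement projections (two projections between the same covers induce the same map).
\<close>

definition cech_homology :: "int \<Rightarrow> 'a topology \<Rightarrow> ('a, 'f::field) thread set" where
  "cech_homology k X =
     {x \<in> (\<Pi>\<^sub>E \<U> \<in> open_covers X. homology k (nerve \<U>)).
        \<forall>\<U> \<in> open_covers X. \<forall>\<V> \<in> open_covers X. \<forall>p.
          refinement_projection \<U> \<V> p \<longrightarrow> homology_map k (nerve \<V>) p (x \<U>) = x \<V>}"

definition cover_trace :: "'a topology \<Rightarrow> 'a set set \<Rightarrow> 'a set set" where
  "cover_trace X \<V> = (\<lambda>V. topspace X \<inter> V) ` \<V>"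

text \<open>
  The map \<open>H\<^sub>k(X) \<rightarrow> H\<^sub>k(Y)\<close> induced by the inclusion of a subspace \<open>X\<close> of \<open>Y\<close>: its component at a
  cover \<open>\<V>\<close> of \<open>Y\<close> is the image of the component at the trace of \<open>\<V>\<close> on \<open>X\<close>. The vertex map sends
  each member of the trace to some member of \<open>\<V>\<close> containing it; the choice is immaterial in homology.
\<close>

definition cech_inclusion ::
  "int \<Rightarrow> 'a topology \<Rightarrow> 'a topology \<Rightarrow> ('a, 'f::field) thread \<Rightarrow> ('a, 'f) thread" where
  "cech_inclusion k X Y x =
     (\<lambda>\<V> \<in> open_covers Y.
        homology_map k (nerve \<V>) (SOME p. refinement_projection (cover_trace X \<V>) \<V> p)
          (x (cover_trace X \<V>)))"

definition cech_zero :: "int \<Rightarrow> 'a topology \<Rightarrow> ('a, 'f::field) thread" where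
  "cech_zero k X = (\<lambda>\<U> \<in> open_covers X. boundaries k (nerve \<U>))"

definition cech_lincomb ::
  "int \<Rightarrow> 'a topology \<Rightarrow> ('a, 'f::field) thread set \<Rightarrow> (('a, 'f) thread \<Rightarrow> 'f) \<Rightarrow> ('a, 'f) thread"
where
  "cech_lincomb k X S a =
     (\<lambda>\<U> \<in> open_covers X. homology_lincomb k (nerve \<U>) S a (\<lambda>x. x \<U>))"

definition cech_independent :: "int \<Rightarrow> 'a topology \<Rightarrow> ('a, 'f::field) thread set \<Rightarrow> bool" where
  "cech_independent k X S \<longleftrightarrow>
     (\<forall>a. cech_lincomb k X S a = cech_zero k X \<longrightarrow> (\<forall>x\<in>S. a x = 0))"

text \<open>Dimension of a linear subspace \<open>V\<close> of the Cech homology of \<open>X\<close>.\<close>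

definition cech_dim :: "int \<Rightarrow> 'a topology \<Rightarrow> ('a, 'f::field) thread set \<Rightarrow> enat" where
  "cech_dim k X V = Sup {enat (card S) | S. S \<subseteq> V \<and> finite S \<and> cech_independent k X S}"


section \<open>Rank invariants\<close>

text \<open>
  The codomain \<open>'b\<close> is \<open>real ^ 'n\<close>, whose order \<open>\<le>\<close> is the componentwise one, or \<open>real\<close>. The
  coefficient field is the type argument.
\<close>

definition sublevel :: "'a topology \<Rightarrow> ('a \<Rightarrow> 'b::ord) \<Rightarrow> 'b \<Rightarrow> 'a topology" where
  "sublevel X \<phi> u = subtopology X {x \<in> topspace X. \<phi> x \<le> u}"

text \<open>
  Meaningful for \<open>u \<prec> v\<close>, the only case used. The values on triangulable spaces with
  continuous \<open>\<phi>\<close> are then finite; \<open>enat\<close> only avoids building this theorem into the definition.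
\<close>

definition rank_invariant ::
  "'f::field itself \<Rightarrow> int \<Rightarrow> 'a topology \<Rightarrow> ('a \<Rightarrow> 'b::ord) \<Rightarrow> 'b \<Rightarrow> 'b \<Rightarrow> enat" where
  "rank_invariant F k X \<phi> u v =
     cech_dim k (sublevel X \<phi> v)
       (cech_inclusion k (sublevel X \<phi> u) (sublevel X \<phi> v) `
          (cech_homology k (sublevel X \<phi> u) :: ('a, 'f) thread set))"


section \<open>Persistence diagrams and matching distance\<close>

text \<open>
  The multiplicities are computed in \<open>ereal\<close> so that the subtraction is not truncated. The infima
  are over nonempty sets of natural numbers, hence minima.
\<close>

definition multiplicity_proper :: "(real \<Rightarrow> real \<Rightarrow> enat) \<Rightarrow> real \<Rightarrow> real \<Rightarrow> ereal" where
  "multiplicity_proper \<rho> u v =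
     (INF \<epsilon> \<in> {\<epsilon>. 0 < \<epsilon> \<and> u + \<epsilon> < v - \<epsilon>}.
        ereal_of_enat (\<rho> (u + \<epsilon>) (v - \<epsilon>)) - ereal_of_enat (\<rho> (u - \<epsilon>) (v - \<epsilon>))
        - ereal_of_enat (\<rho> (u + \<epsilon>) (v + \<epsilon>)) + ereal_of_enat (\<rho> (u - \<epsilon>) (v + \<epsilon>)))"

definition multiplicity_infinity :: "(real \<Rightarrow> real \<Rightarrow> enat) \<Rightarrow> real \<Rightarrow> ereal" where
  "multiplicity_infinity \<rho> u =
     (INF \<epsilon> \<in> {\<epsilon>. 0 < \<epsilon> \<and> u + \<epsilon> < 1 / \<epsilon>}.
        ereal_of_enat (\<rho> (u + \<epsilon>) (1 / \<epsilon>)) - ereal_of_enat (\<rho> (u - \<epsilon>) (1 / \<epsilon>)))"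

text \<open>
  A multiset of points of multiplicity at most countably infinite is represented by the set of pairs
  \<open>(p, i)\<close> with \<open>i\<close> a natural number less than the multiplicity of \<open>p\<close>. Bijections of multisets
  are then bijections of these sets.
\<close>

definition persistence_diagram :: "(real \<Rightarrow> real \<Rightarrow> enat) \<Rightarrow> ((real \<times> ereal) \<times> nat) set" where
  "persistence_diagram \<rho> =
     {((u, ereal v), i) | u v i. u < v \<and> ereal (real i) < multiplicity_proper \<rho> u v} \<union>
     {((u, \<infinity>), i) | u i. ereal (real i) < multiplicity_infinity \<rho> u} \<union>
     {((u, ereal u), i) | u i. True}"

text \<open>The case distinction implements \<open>\<infinity> - \<infinity> = 0\<close>, whereas \<open>\<infinity> - \<infinity> = \<infinity>\<close> in \<open>ereal\<close>.\<close>

definition ext_dist :: "ereal \<Rightarrow> ereal \<Rightarrow> ereal" where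
  "ext_dist v v' = (if v = v' then 0 else \<bar>v - v'\<bar>)"

definition point_dist :: "real \<times> ereal \<Rightarrow> real \<times> ereal \<Rightarrow> ereal" where
  "point_dist p q =
     (case (p, q) of ((u, v), (u', v')) \<Rightarrow>
        min (max (ereal \<bar>u - u'\<bar>) (ext_dist v v'))
            (max ((v - ereal u) / 2) ((v' - ereal u') / 2)))"

definition d_match :: "(real \<Rightarrow> real \<Rightarrow> enat) \<Rightarrow> (real \<Rightarrow> real \<Rightarrow> enat) \<Rightarrow> ereal" where
  "d_match \<rho> \<rho>' =
     (INF \<gamma> \<in> {\<gamma>. bij_betw \<gamma> (persistence_diagram \<rho>) (persistence_diagram \<rho>')}.
        SUP p \<in> persistence_diagram \<rho>. point_dist (fst p) (fst (\<gamma> p)))"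


section \<open>Multidimensional matching distances\<close>

definition Delta_plus :: "((real ^ 'n) \<times> (real ^ 'n)) set" where
  "Delta_plus = {(u, v). \<forall>i. u $ i < v $ i}"

definition half_plane :: "real ^ 'n \<Rightarrow> real ^ 'n \<Rightarrow> ((real ^ 'n) \<times> (real ^ 'n)) set" where
  "half_plane l b = {(s *\<^sub>R l + b, t *\<^sub>R l + b) | s t. s < t}"

definition reduced_filtering :: "('a \<Rightarrow> real ^ 'n) \<Rightarrow> real ^ 'n \<Rightarrow> real ^ 'n \<Rightarrow> 'a \<Rightarrow> real" where
  "reduced_filtering \<phi> l b x = (MAX i. (\<phi> x $ i - b $ i) / l $ i)"

definition Adm :: "((real ^ 'n) \<times> (real ^ 'n)) set" where
  "Adm = {(l, b). (\<forall>i. 0 < l $ i) \<and> (\<Sum>i\<in>UNIV. (l $ i)\<^sup>2) = 1 \<and> (\<Sum>i\<in>UNIV. b $ i) = 0}"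

definition D_match ::
  "'f::field itself \<Rightarrow> int \<Rightarrow> 'a topology \<Rightarrow> ('a \<Rightarrow> real ^ 'n) \<Rightarrow> 'b topology \<Rightarrow> ('b \<Rightarrow> real ^ 'n) \<Rightarrow> ereal"
where
  "D_match F k X \<phi> Y \<psi> =
     (SUP (l, b) \<in> Adm.
        ereal (MIN i. l $ i) *
        d_match (rank_invariant F k X (reduced_filtering \<phi> l b))
                (rank_invariant F k Y (reduced_filtering \<psi> l b)))"

definition D_match_hat ::
  "'f::field itself \<Rightarrow> int \<Rightarrow> (real ^ 'n) set \<Rightarrow> (real ^ 'n) set \<Rightarrow>
   'a topology \<Rightarrow> ('a \<Rightarrow> real ^ 'n) \<Rightarrow> 'b topology \<Rightarrow> ('b \<Rightarrow> real ^ 'n) \<Rightarrow> ereal"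
where
  "D_match_hat F k \<Lambda> B X \<phi> Y \<psi> =
     (SUP (l, b) \<in> \<Lambda> \<times> B.
        ereal (MIN i. l $ i) *
        d_match (rank_invariant F k X (reduced_filtering \<phi> l b))
                (rank_invariant F k Y (reduced_filtering \<psi> l b)))"

end

theory Submission
  imports Defs "HOL-Library.Function_Algebras"
begin

text \<open>
  Both distances are suprema of the same quantity over a family of half-planes of
  \<open>Delta_plus\<close>, each half-plane being described by a direction \<open>l\<close> and a base point \<open>b\<close>. Every
  half-plane of \<open>\<Lambda> \<times> B\<close> has an admissible description, by normalizing \<open>l\<close> and sliding \<open>b\<close>
  along it. Conversely an admissible half-plane contains the pair \<open>(b, l + b)\<close> of \<open>Delta_plus\<close>,
  the half-plane of \<open>\<Lambda> \<times> B\<close> through this pair lies on the same line, and so it is the same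
  half-plane. It remains to see that the quantity depends on the half-plane only.

  Two descriptions of a half-plane are related by \<open>l' = c l\<close> and \<open>b' = b + d l\<close> with \<open>c > 0\<close>, and the
  reduced filtering functions then satisfy \<open>F' = (F - d) / c\<close>. So the rank invariant of \<open>F'\<close> is that
  of \<open>F\<close> precomposed with the affine map \<open>t \<mapsto> c t + d\<close>. This map should carry the persistence
  diagrams of \<open>F'\<close> onto those of \<open>F\<close> and multiply all distances by \<open>c\<close>, so that \<open>d_match\<close> is
  divided by \<open>c\<close> on passing to \<open>F'\<close>, while the weight \<open>min l\<close> is multiplied by \<open>c\<close>: the
  product does not change (\<open>weighted_d_match_rescaled_parameters\<close>).

  One point of this needs an argument: the multiplicity of a point at infinity is computed along the
  curve \<open>v = 1 / \<epsilon>\<close>, which is not invariant under the affine map. It is, however, an infimum over all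
  \<open>\<epsilon>\<close> and \<open>v\<close> with \<open>u + \<epsilon> < v\<close> (\<open>multiplicity_infinity_eq\<close>), a description that is invariant, because
  the difference \<open>\<rho> (u + \<epsilon>) v - \<rho> (u - \<epsilon>) v\<close> can only decrease as \<open>\<epsilon>\<close> decreases and \<open>v\<close> grows. This
  monotonicity is linear algebra: applying a linear map to nested spaces \<open>V \<subseteq> W\<close> cannot increase
  \<open>dim W - dim V\<close> (\<open>ext_dim_image_diff_le\<close>). To apply it to Cech homology one needs that the maps
  induced by inclusions are linear and functorial. The latter rests on the fact that two refinement
  projections between the same covers induce the same map in the homology of the nerves,
  which is the prism construction (\<open>chain_boundary_prism\<close>).
\<close>

section \<open>Chains, boundaries and cones\<close>

lemma lookup_chain_scale [simp]:
  "Poly_Mapping.lookup (chain_scale a c) x = a * Poly_Mapping.lookup c x"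
  by (simp add: chain_scale_def Poly_Mapping.map.rep_eq when_def)

interpretation chain: vector_space "chain_scale :: 'f::field \<Rightarrow> ('v, 'f) chain \<Rightarrow> ('v, 'f) chain"
  by unfold_locales (rule poly_mapping_eqI; simp add: lookup_add algebra_simps)+

interpretation chain_pair: vector_space_pair
  "chain_scale :: 'f::field \<Rightarrow> ('v, 'f) chain \<Rightarrow> ('v, 'f) chain"
  "chain_scale :: 'f::field \<Rightarrow> ('w, 'f) chain \<Rightarrow> ('w, 'f) chain"
  by unfold_locales

abbreviation chain_linear :: "(('v, 'f::field) chain \<Rightarrow> ('w, 'f) chain) \<Rightarrow> bool" where
  "chain_linear \<equiv> Vector_Spaces.linear chain_scale chain_scale"

abbreviation simplex_chain :: "'v list \<Rightarrow> ('v, 'f::field) chain" where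
  "simplex_chain vs \<equiv> Poly_Mapping.single vs 1"

lemma chain_scale_single: "chain_scale a (Poly_Mapping.single vs b) = Poly_Mapping.single vs (a * b)"
  by (rule poly_mapping_eqI) (simp add: lookup_single when_def)

lemma chain_expand:
  assumes "finite A" "Poly_Mapping.keys c \<subseteq> A"
  shows "c = (\<Sum>vs\<in>A. chain_scale (Poly_Mapping.lookup c vs) (simplex_chain vs))"
proof (rule poly_mapping_eqI)
  fix xs
  have "Poly_Mapping.lookup c xs = 0" if "xs \<notin> A"
    using that assms by (meson in_keys_iff subsetD)
  then show "Poly_Mapping.lookup c xs =
      Poly_Mapping.lookup (\<Sum>vs\<in>A. chain_scale (Poly_Mapping.lookup c vs) (simplex_chain vs)) xs"
    using assms(1) by (simp add: lookup_sum lookup_single when_def if_distrib cong: if_cong)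
qed

text \<open>
  Identities between linear operators on chains are proved throughout on single simplices.
\<close>

lemma chain_linear_eqI:
  assumes "chain_linear f" "chain_linear g"
    and "\<And>vs. vs \<in> Poly_Mapping.keys c \<Longrightarrow> f (simplex_chain vs) = g (simplex_chain vs)"
  shows "f c = g c"
proof -
  interpret f: Vector_Spaces.linear chain_scale chain_scale f by fact
  interpret g: Vector_Spaces.linear chain_scale chain_scale g by fact
  have c: "c = (\<Sum>vs\<in>Poly_Mapping.keys c. chain_scale (Poly_Mapping.lookup c vs) (simplex_chain vs))"
    by (rule chain_expand) auto
  show ?thesis
    by (subst (1 2) c) (simp add: f.sum g.sum f.scale g.scale assms(3))
qed

definition linear_extension :: "('v list \<Rightarrow> ('w, 'f) chain) \<Rightarrow> ('v, 'f::field) chain \<Rightarrow> ('w, 'f) chain" where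
  "linear_extension g c = (\<Sum>vs \<in> Poly_Mapping.keys c. chain_scale (Poly_Mapping.lookup c vs) (g vs))"

lemma linear_extension_superset:
  assumes "finite A" "Poly_Mapping.keys c \<subseteq> A"
  shows "linear_extension g c = (\<Sum>vs\<in>A. chain_scale (Poly_Mapping.lookup c vs) (g vs))"
  unfolding linear_extension_def
  by (rule sum.mono_neutral_left) (use assms in \<open>auto simp: in_keys_iff\<close>)

lemma chain_linear_linear_extension:
  fixes g :: "'v list \<Rightarrow> ('w, 'f::field) chain"
  shows "chain_linear (linear_extension g)"
proof (unfold Vector_Spaces.linear_iff, intro conjI allI)
  show "vector_space (chain_scale :: 'f \<Rightarrow> ('v, 'f) chain \<Rightarrow> _)"
    "vector_space (chain_scale :: 'f \<Rightarrow> ('w, 'f) chain \<Rightarrow> _)"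
    by unfold_locales
next
  fix b1 b2 :: "('v, 'f) chain"
  let ?A = "Poly_Mapping.keys b1 \<union> Poly_Mapping.keys b2"
  have "Poly_Mapping.keys (b1 + b2) \<subseteq> ?A" by (rule Poly_Mapping.keys_add)
  then show "linear_extension g (b1 + b2) = linear_extension g b1 + linear_extension g b2"
    by (simp add: linear_extension_superset[where A = ?A] lookup_add chain.scale_left_distrib sum.distrib)
next
  fix r :: 'f and b :: "('v, 'f) chain"
  have "Poly_Mapping.keys (chain_scale r b) \<subseteq> Poly_Mapping.keys b" by (auto simp: in_keys_iff)
  then show "linear_extension g (chain_scale r b) = chain_scale r (linear_extension g b)"
    by (simp add: linear_extension_superset[where A = "Poly_Mapping.keys b"] chain.scale_sum_right)
qed

lemma linear_extension_simplex [simp]: "linear_extension g (simplex_chain vs) = g vs"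
  by (simp add: linear_extension_def)

lemma chain_map_eq: "chain_map p = linear_extension (\<lambda>vs. simplex_chain (map p vs))"
  by (rule ext) (simp add: chain_map_def linear_extension_def chain_scale_single)

lemma chain_linear_chain_map: "chain_linear (chain_map p)"
  by (simp add: chain_map_eq chain_linear_linear_extension)

lemma chain_map_simplex [simp]: "chain_map p (simplex_chain vs) = simplex_chain (map p vs)"
  by (simp add: chain_map_eq)

definition simplex_boundary :: "'v list \<Rightarrow> ('v, 'f::field) chain" where
  "simplex_boundary vs =
     (\<Sum>i<length vs. Poly_Mapping.single (take i vs @ drop (Suc i) vs) ((- 1) ^ i))"

lemma chain_boundary_eq:
  "chain_boundary = linear_extension (\<lambda>vs. if length vs \<le> 1 then 0 else simplex_boundary vs)"
  by (rule ext) (auto simp: chain_boundary_def linear_extension_def simplex_boundary_def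
      chain_scale_single chain.scale_sum_right mult.commute intro!: sum.cong)

lemma chain_linear_chain_boundary: "chain_linear chain_boundary"
  by (simp add: chain_boundary_eq chain_linear_linear_extension)

text \<open>
  The boundary with the empty list as a simplex of degree \<open>-1\<close>. Unlike \<open>chain_boundary\<close>, which
  vanishes on vertices, it satisfies the cone identity in every degree, so that inductions over
  lists of vertices need no case distinction on the degree.
\<close>

definition augmented_boundary :: "('v, 'f::field) chain \<Rightarrow> ('v, 'f) chain" where
  "augmented_boundary = linear_extension simplex_boundary"

definition cone :: "'v \<Rightarrow> ('v, 'f::field) chain \<Rightarrow> ('v, 'f) chain" where
  "cone v = linear_extension (\<lambda>vs. simplex_chain (v # vs))"

lemma chain_linear_augmented_boundary: "chain_linear augmented_boundary"
  by (simp add: augmented_boundary_def chain_linear_linear_extension)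

lemma chain_linear_cone: "chain_linear (cone v)"
  by (simp add: cone_def chain_linear_linear_extension)

lemma cone_simplex [simp]: "cone v (simplex_chain vs) = simplex_chain (v # vs)"
  by (simp add: cone_def)

lemma augmented_boundary_simplex [simp]: "augmented_boundary (simplex_chain vs) = simplex_boundary vs"
  by (simp add: augmented_boundary_def)

lemma cone_single [simp]: "cone v (Poly_Mapping.single vs a) = Poly_Mapping.single (v # vs) a"
proof -
  interpret Vector_Spaces.linear chain_scale chain_scale "cone v" by (rule chain_linear_cone)
  show ?thesis
    using scale[of a "simplex_chain vs"] by (simp add: chain_scale_single)
qed

lemma simplex_boundary_Nil [simp]: "simplex_boundary [] = 0"
  by (simp add: simplex_boundary_def)

text \<open>
  Deleting the first vertex leaves \<open>vs\<close>; deleting a later one keeps \<open>v\<close> in front and shifts the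
  alternating sign by one.
\<close>

lemma simplex_boundary_Cons [simp]: "simplex_boundary (v # vs) = simplex_chain vs - cone v (simplex_boundary vs)"
proof -
  interpret Vector_Spaces.linear chain_scale chain_scale "cone v" by (rule chain_linear_cone)
  have "cone v (simplex_boundary vs) =
      (\<Sum>i<length vs. Poly_Mapping.single (v # take i vs @ drop (Suc i) vs) ((- 1) ^ i))"
    by (simp add: simplex_boundary_def sum)
  then show ?thesis unfolding \<open>cone v _ = _\<close>
    by (simp add: simplex_boundary_def[of "v # vs"] sum.lessThan_Suc_shift single_uminus sum_negf del: sum.lessThan_Suc)
qed

lemma augmented_boundary_cone: "augmented_boundary (cone v c) = c - cone v (augmented_boundary c)"
proof -
  have "chain_linear (augmented_boundary \<circ> cone v)"
    by (rule Vector_Spaces.linear_compose[OF chain_linear_cone chain_linear_augmented_boundary])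
  moreover have "chain_linear (\<lambda>c. c - (cone v \<circ> augmented_boundary) c)"
    by (intro chain_pair.linear_compose_sub chain.linear_ident
        Vector_Spaces.linear_compose[OF chain_linear_augmented_boundary chain_linear_cone])
  ultimately have "(augmented_boundary \<circ> cone v) c = c - (cone v \<circ> augmented_boundary) c"
    by (rule chain_linear_eqI) simp
  then show ?thesis by simp
qed

section \<open>Chain homotopy between contiguous maps\<close>

lemma chain_linear_compose: "chain_linear f \<Longrightarrow> chain_linear g \<Longrightarrow> chain_linear (g \<circ> f)"
  by (rule Vector_Spaces.linear_compose)

lemma chain_map_cone: "chain_map p (cone v c) = cone (p v) (chain_map p c)"
proof -
  have "(chain_map p \<circ> cone v) c = (cone (p v) \<circ> chain_map p) c"
    by (rule chain_linear_eqI[where f = "chain_map p \<circ> cone v" and g = "cone (p v) \<circ> chain_map p"])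
      (auto intro!: chain_linear_compose chain_linear_cone chain_linear_chain_map)
  then show ?thesis by simp
qed

lemmas augmented_boundary_diff = chain_pair.linear_diff[OF chain_linear_augmented_boundary]
lemmas chain_map_diff = chain_pair.linear_diff[OF chain_linear_chain_map]
lemmas chain_map_add = chain_pair.linear_add[OF chain_linear_chain_map]
lemmas cone_diff = chain_pair.linear_diff[OF chain_linear_cone]
lemmas cone_0 = chain_pair.linear_0[OF chain_linear_cone]
lemmas chain_map_0 = chain_pair.linear_0[OF chain_linear_chain_map]

lemma chain_map_simplex_boundary: "chain_map p (simplex_boundary vs) = simplex_boundary (map p vs)"
  by (induction vs) (simp_all add: chain_map_0 chain_map_diff chain_map_cone)

lemma chain_map_chain_boundary: "chain_boundary (chain_map p c) = chain_map p (chain_boundary c)"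
proof -
  have "(chain_boundary \<circ> chain_map p) c = (chain_map p \<circ> chain_boundary) c"
  proof (rule chain_linear_eqI[where f = "chain_boundary \<circ> chain_map p" and g = "chain_map p \<circ> chain_boundary"])
    show "(chain_boundary \<circ> chain_map p) (simplex_chain vs) = (chain_map p \<circ> chain_boundary) (simplex_chain vs)"
      for vs by (simp add: chain_boundary_eq chain_map_simplex_boundary chain_map_0)
  qed (intro chain_linear_compose chain_linear_chain_boundary chain_linear_chain_map)+
  then show ?thesis by simp
qed

lemma chain_map_compose: "chain_map q (chain_map p c) = chain_map (q \<circ> p) c"
proof -
  have "(chain_map q \<circ> chain_map p) c = chain_map (q \<circ> p) c"
    by (rule chain_linear_eqI[where f = "chain_map q \<circ> chain_map p" and g = "chain_map (q \<circ> p)"])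
      (auto intro!: chain_linear_compose chain_linear_chain_map)
  then show ?thesis by simp
qed

text \<open>
  The prism over a simplex, with bottom \<open>map p vs\<close> and top \<open>map q vs\<close>. It unfolds to the alternating
  sum of the lists \<open>p v\<^sub>0, \<dots>, p v\<^sub>i, q v\<^sub>i, \<dots>, q v\<^sub>k\<close>; the recursive form reduces its boundary to the cone
  identity.
\<close>

primrec prism_simplex :: "('v \<Rightarrow> 'w) \<Rightarrow> ('v \<Rightarrow> 'w) \<Rightarrow> 'v list \<Rightarrow> ('w, 'f::field) chain" where
  "prism_simplex p q [] = 0"
| "prism_simplex p q (v # vs) = simplex_chain (p v # q v # map q vs) - cone (p v) (prism_simplex p q vs)"

definition prism :: "('v \<Rightarrow> 'w) \<Rightarrow> ('v \<Rightarrow> 'w) \<Rightarrow> ('v, 'f::field) chain \<Rightarrow> ('w, 'f) chain" where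
  "prism p q = linear_extension (prism_simplex p q)"

lemma chain_linear_prism: "chain_linear (prism p q)"
  by (simp add: prism_def chain_linear_linear_extension)

lemma prism_simplex_chain [simp]: "prism p q (simplex_chain vs) = prism_simplex p q vs"
  by (simp add: prism_def)

lemmas prism_diff = chain_pair.linear_diff[OF chain_linear_prism]
lemmas prism_0 = chain_pair.linear_0[OF chain_linear_prism]

lemma prism_cone:
  "prism p q (cone v c) = cone (p v) (cone (q v) (chain_map q c)) - cone (p v) (prism p q c)"
proof -
  have "(prism p q \<circ> cone v) c =
      (cone (p v) \<circ> (cone (q v) \<circ> chain_map q)) c - (cone (p v) \<circ> prism p q) c"
    by (rule chain_linear_eqI[where f = "prism p q \<circ> cone v" and
          g = "\<lambda>c. (cone (p v) \<circ> (cone (q v) \<circ> chain_map q)) c - (cone (p v) \<circ> prism p q) c"])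
      (intro chain_linear_compose chain_linear_chain_map chain_linear_cone
        chain_linear_prism chain_pair.linear_compose_sub | simp)+
  then show ?thesis by simp
qed

text \<open>
  Induction on the vertices. In the step both summands on the left produce the prism over \<open>vs\<close>, with
  opposite signs, and what remains under the cone with apex \<open>p v\<close> is governed by the induction
  hypothesis.
\<close>

lemma augmented_boundary_prism_simplex:
  fixes p q :: "'v \<Rightarrow> 'w"
  shows "augmented_boundary (prism_simplex p q vs) + prism p q (simplex_boundary vs) =
     (simplex_chain (map q vs) - simplex_chain (map p vs) :: ('w, 'f::field) chain)"
proof (induction vs)
  case Nil
  show ?case
    by (simp add: prism_0 chain_pair.linear_0[OF chain_linear_augmented_boundary])
next
  case (Cons v vs)
  have "augmented_boundary (prism_simplex p q vs) =
      (simplex_chain (map q vs) - simplex_chain (map p vs) - prism p q (simplex_boundary vs) :: ('w, 'f) chain)"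
    by (simp add: Cons.IH[symmetric])
  then show ?case
    by (simp add: augmented_boundary_diff augmented_boundary_cone prism_diff prism_cone cone_diff
        chain_map_simplex_boundary)
qed

lemma keys_chain_scale: "Poly_Mapping.keys (chain_scale a c) \<subseteq> Poly_Mapping.keys c"
  by (auto simp: in_keys_iff)

lemma keys_linear_extension:
  "Poly_Mapping.keys (linear_extension g c) \<subseteq> (\<Union>vs\<in>Poly_Mapping.keys c. Poly_Mapping.keys (g vs))"
  unfolding linear_extension_def
  by (rule order_trans[OF Poly_Mapping.keys_sum], rule UN_mono) (auto simp: keys_chain_scale)

lemma keys_cone: "Poly_Mapping.keys (cone v c) \<subseteq> (#) v ` Poly_Mapping.keys c"
  unfolding cone_def by (rule order_trans[OF keys_linear_extension]) auto

lemma keys_prism_simplex: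
  fixes p q :: "'v \<Rightarrow> 'w"
  shows "ws \<in> Poly_Mapping.keys (prism_simplex p q vs :: ('w, 'f::field) chain) \<Longrightarrow>
     length ws = Suc (length vs) \<and> set ws \<subseteq> p ` set vs \<union> q ` set vs"
proof (induction vs arbitrary: ws)
  case (Cons v vs)
  let ?P = "prism_simplex p q vs :: ('w, 'f) chain"
  have "ws \<in> Poly_Mapping.keys (simplex_chain (p v # q v # map q vs) :: ('w, 'f) chain) \<union>
      Poly_Mapping.keys (cone (p v) ?P)"
    using Cons.prems subsetD[OF keys_diff] by (simp only: prism_simplex.simps)
  then consider "ws = p v # q v # map q vs" | us where "us \<in> Poly_Mapping.keys ?P" "ws = p v # us"
    using keys_cone[of "p v" ?P] by auto
  then show ?case
  proof cases
    case 2
    with Cons.IH[OF 2(1)] show ?thesis by auto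
  qed auto
qed simp

lemma chain_boundary_eq_augmented_boundary:
  assumes "\<And>vs. vs \<in> Poly_Mapping.keys c \<Longrightarrow> 2 \<le> length vs"
  shows "chain_boundary c = augmented_boundary c"
  by (rule chain_linear_eqI[OF chain_linear_chain_boundary chain_linear_augmented_boundary])
    (use assms in \<open>fastforce simp: chain_boundary_eq\<close>)

text \<open>
  The homotopy identity survives the passage to the unaugmented boundary: the two boundaries differ
  only on single vertices, where \<open>augmented_boundary\<close> yields the empty list; the prism over the empty list
  is zero, and no prism contains a list of length one.
\<close>

lemma chain_boundary_prism:
  fixes c :: "('v, 'f::field) chain"
    and p q :: "'v \<Rightarrow> 'w"
  shows "chain_boundary (prism p q c) + prism p q (chain_boundary c) = chain_map q c - chain_map p c"
proof -
  have "(chain_boundary \<circ> prism p q) c + (prism p q \<circ> chain_boundary) c = chain_map q c - chain_map p c"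
  proof (rule chain_linear_eqI[where f = "\<lambda>c. (chain_boundary \<circ> prism p q) c + (prism p q \<circ> chain_boundary) c" and g = "\<lambda>c. chain_map q c - chain_map p c"])
    fix vs :: "'v list"
    have prism: "prism p q (chain_boundary (simplex_chain vs :: ('v, 'f) chain)) = prism p q (simplex_boundary vs)"
    proof (cases "length vs \<le> 1")
      case True
      then have "vs = [] \<or> (\<exists>v. vs = [v])" by (cases vs) auto
      then show ?thesis by (auto simp: chain_boundary_eq cone_0 prism_0)
    qed (simp add: chain_boundary_eq)
    have boundary: "chain_boundary (prism_simplex p q vs :: ('w, 'f) chain) =
        augmented_boundary (prism_simplex p q vs)"
    proof (cases vs)
      case Nil
      then show ?thesis
        by (simp add: chain_pair.linear_0 chain_linear_chain_boundary chain_linear_augmented_boundary)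
    next
      case (Cons v us)
      then show ?thesis
        by (intro chain_boundary_eq_augmented_boundary) (auto dest: keys_prism_simplex simp del: prism_simplex.simps)
    qed
    show "(chain_boundary \<circ> prism p q) (simplex_chain vs :: ('v, 'f) chain) + (prism p q \<circ> chain_boundary) (simplex_chain vs) =
        chain_map q (simplex_chain vs) - chain_map p (simplex_chain vs)"
      using augmented_boundary_prism_simplex[of p q vs] by (simp add: prism boundary)
  qed (intro chain_pair.linear_compose_add chain_pair.linear_compose_sub chain_linear_compose
      chain_linear_chain_map chain_linear_prism chain_linear_chain_boundary)+
  then show ?thesis by simp
qed

text \<open>
  The two maps send every simplex to faces of a common simplex. Since \<open>\<tau>\<close> ranges over all nonempty
  faces, this contains the statement that \<open>p\<close> and \<open>q\<close> are simplicial, if simplices are nonempty.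
\<close>

definition contiguous :: "('v \<Rightarrow> 'w) \<Rightarrow> ('v \<Rightarrow> 'w) \<Rightarrow> 'v set set \<Rightarrow> 'w set set \<Rightarrow> bool" where
  "contiguous p q N N' \<longleftrightarrow> (\<forall>\<sigma>\<in>N. \<forall>\<tau>. \<tau> \<noteq> {} \<longrightarrow> \<tau> \<subseteq> p ` \<sigma> \<union> q ` \<sigma> \<longrightarrow> \<tau> \<in> N')"

lemma chain_map_in_chains:
  fixes c :: "('v, 'f::field) chain"
  assumes "contiguous p q N N'" "{} \<notin> N" "c \<in> chains k N"
  shows "chain_map p c \<in> chains k N'"
proof -
  have "set ws \<in> N' \<and> int (length ws) = k + 1" if ws: "ws \<in> Poly_Mapping.keys (chain_map p c)" for ws
  proof -
    obtain vs where vs: "vs \<in> Poly_Mapping.keys c" "ws = map p vs"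
      using ws subsetD[OF keys_linear_extension, of ws "\<lambda>vs. simplex_chain (map p vs)" c]
      by (auto simp: chain_map_eq)
    then have "set vs \<in> N" "int (length vs) = k + 1"
      using assms(3) by (auto simp: chains_def)
    with vs assms(1,2) show ?thesis
      unfolding contiguous_def by (auto dest!: bspec spec[of _ "p ` set vs"])
  qed
  then show ?thesis by (simp add: chains_def)
qed

lemma prism_in_chains:
  fixes c :: "('v, 'f::field) chain" and p q :: "'v \<Rightarrow> 'w"
  assumes "contiguous p q N N'" "{} \<notin> N" "c \<in> chains k N"
  shows "prism p q c \<in> chains (k + 1) N'"
proof -
  have "set ws \<in> N' \<and> int (length ws) = k + 1 + 1" if ws: "ws \<in> Poly_Mapping.keys (prism p q c)" for ws
  proof -
    obtain vs where vs: "vs \<in> Poly_Mapping.keys c" "ws \<in> Poly_Mapping.keys (prism_simplex p q vs :: ('w, 'f) chain)"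
      using ws subsetD[OF keys_linear_extension, of ws "prism_simplex p q" c]
      by (auto simp: prism_def)
    have N: "set vs \<in> N" "int (length vs) = k + 1"
      using assms(3) vs by (auto simp: chains_def)
    have len: "length ws = Suc (length vs)" "set ws \<subseteq> p ` set vs \<union> q ` set vs"
      using keys_prism_simplex[OF vs(2)] by auto
    then have "set ws \<noteq> {}" by auto
    with len(2) N(1) assms(1) have "set ws \<in> N'"
      unfolding contiguous_def by blast
    with len N show ?thesis by simp
  qed
  then show ?thesis by (simp add: chains_def)
qed

lemma subspace_chains: "chain.subspace (chains k N :: ('v, 'f::field) chain set)"
proof (rule chain.subspaceI)
  show "x + y \<in> chains k N" if "x \<in> chains k N" "y \<in> chains k N" for x y :: "('v, 'f) chain"
    using that Poly_Mapping.keys_add[of x y] by (auto simp: chains_def)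
  show "chain_scale a x \<in> chains k N" if "x \<in> chains k N" for x :: "('v, 'f) chain" and a
    using that keys_chain_scale[of a x] by (auto simp: chains_def)
qed (simp add: chains_def)

lemma subspace_boundaries: "chain.subspace (boundaries k N)"
  unfolding boundaries_def
  by (rule chain_pair.linear_subspace_image[OF chain_linear_chain_boundary subspace_chains])

lemma chain_map_in_cycles:
  assumes "contiguous p q N N'" "{} \<notin> N" "c \<in> cycles k N"
  shows "chain_map p c \<in> cycles k N'"
  using assms by (auto simp: cycles_def chain_map_in_chains chain_map_chain_boundary chain_map_0)

lemma chain_map_in_boundaries:
  assumes "contiguous p q N N'" "{} \<notin> N" "c \<in> boundaries k N"
  shows "chain_map p c \<in> boundaries k N'"
proof -
  obtain d where "d \<in> chains (k + 1) N" "c = chain_boundary d"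
    using assms(3) by (auto simp: boundaries_def)
  then show ?thesis
    using chain_map_in_chains[OF assms(1,2)] chain_map_chain_boundary[of p d]
    unfolding boundaries_def by (metis imageI)
qed

lemma contiguous_chain_maps_homologous:
  assumes "contiguous p q N N'" "{} \<notin> N" "z \<in> cycles k N"
  shows "chain_map q z - chain_map p z \<in> boundaries k N'"
proof -
  have "chain_map q z - chain_map p z = chain_boundary (prism p q z)"
    using chain_boundary_prism[of p q z] assms(3) by (simp add: cycles_def prism_0)
  then show ?thesis
    using prism_in_chains[OF assms(1,2)] assms(3) by (auto simp: boundaries_def cycles_def)
qed

lemma (in module) coset_eq_iff:
  assumes "subspace W"
  shows "(+) x ` W = (+) y ` W \<longleftrightarrow> x - y \<in> W"
proof
  assume "(+) x ` W = (+) y ` W"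
  moreover have "x + 0 \<in> (+) x ` W" using subspace_0[OF assms] by blast
  ultimately obtain w where "w \<in> W" "x = y + w" by auto
  then show "x - y \<in> W" by simp
next
  have sub: "(+) x ` W \<subseteq> (+) y ` W" if "x - y \<in> W" for x y
  proof
    fix t assume "t \<in> (+) x ` W"
    then obtain w where "w \<in> W" "t = x + w" by auto
    then have "t = y + (x - y + w)" "x - y + w \<in> W"
      using subspace_add[OF assms that] by (auto simp: algebra_simps)
    then show "t \<in> (+) y ` W" by blast
  qed
  assume "x - y \<in> W"
  moreover from this have "y - x \<in> W" using subspace_neg[OF assms] by fastforce
  ultimately show "(+) x ` W = (+) y ` W" using sub by blast
qed

lemma homology_map_coset:
  assumes "contiguous p q N N'" "{} \<notin> N"
  shows "homology_map k N' p ((+) z ` boundaries k N) = (+) (chain_map p z) ` boundaries k N'"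
proof (intro equalityI subsetI)
  fix t assume "t \<in> homology_map k N' p ((+) z ` boundaries k N)"
  then obtain b1 b2 where b: "b1 \<in> boundaries k N" "b2 \<in> boundaries k N'"
      "t = chain_map p (z + b1) + b2"
    by (auto simp: homology_map_def)
  have "chain_map p b1 + b2 \<in> boundaries k N'"
    by (intro chain.subspace_add subspace_boundaries chain_map_in_boundaries[OF assms] b)
  then show "t \<in> (+) (chain_map p z) ` boundaries k N'"
    using b(3) by (simp add: chain_map_add add.assoc)
next
  fix t assume "t \<in> (+) (chain_map p z) ` boundaries k N'"
  moreover have "z \<in> (+) z ` boundaries k N"
    using chain.subspace_0[OF subspace_boundaries] by (metis add_0_right imageI)
  ultimately show "t \<in> homology_map k N' p ((+) z ` boundaries k N)"
    unfolding homology_map_def by blast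
qed

section \<open>Representatives of Cech homology classes\<close>

lemma empty_notin_nerve: "{} \<notin> nerve \<U>"
  by (simp add: nerve_def)

text \<open>
  A point in all members of a simplex \<open>\<sigma>\<close> of the nerve also lies in their images under \<open>p\<close> and
  \<open>q\<close>.
\<close>

lemma contiguous_refinement_projections:
  assumes "refinement_projection \<U> \<V> p" "refinement_projection \<U> \<V> q"
  shows "contiguous p q (nerve \<U>) (nerve \<V>)"
  unfolding contiguous_def
proof (intro ballI allI impI)
  fix \<sigma> \<tau> assume \<sigma>: "\<sigma> \<in> nerve \<U>" and \<tau>: "\<tau> \<noteq> {}" "\<tau> \<subseteq> p ` \<sigma> \<union> q ` \<sigma>"
  then obtain x where x: "x \<in> \<Inter>\<sigma>" by (auto simp: nerve_def)
  have "x \<in> V" if V: "V \<in> \<tau>" for V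
  proof -
    obtain U where "U \<in> \<sigma>" "V = p U \<or> V = q U" using subsetD[OF \<tau>(2) V] by auto
    moreover from \<open>U \<in> \<sigma>\<close> \<sigma> have "U \<in> \<U>" by (auto simp: nerve_def)
    ultimately show ?thesis using x assms unfolding refinement_projection_def by blast
  qed
  then have "\<Inter>\<tau> \<noteq> {}" by blast
  moreover have "finite \<tau>" using \<sigma> finite_subset[OF \<tau>(2)] by (simp add: nerve_def)
  moreover have "p ` \<sigma> \<union> q ` \<sigma> \<subseteq> \<V>" using \<sigma> assms by (auto simp: nerve_def refinement_projection_def)
  then have "\<tau> \<subseteq> \<V>" using \<tau>(2) by (rule order_trans[rotated])
  ultimately show "\<tau> \<in> nerve \<V>" using \<tau> by (simp add: nerve_def)
qed

lemma refinement_projection_compose: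
  "refinement_projection \<U> \<V> p \<Longrightarrow> refinement_projection \<V> \<W> q \<Longrightarrow> refinement_projection \<U> \<W> (q \<circ> p)"
  unfolding refinement_projection_def by (metis comp_apply subset_trans)

lemmas projection_in_cycles =
  chain_map_in_cycles[OF contiguous_refinement_projections empty_notin_nerve]
lemmas projection_in_boundaries =
  chain_map_in_boundaries[OF contiguous_refinement_projections empty_notin_nerve]
lemmas projections_homologous =
  contiguous_chain_maps_homologous[OF contiguous_refinement_projections empty_notin_nerve]
lemmas projection_coset =
  homology_map_coset[OF contiguous_refinement_projections empty_notin_nerve]
lemmas coset_boundaries_eq_iff = chain.coset_eq_iff[OF subspace_boundaries]

text \<open>
  Threads take values in sets of chains and so do not form a vector space as a type. They are
  therefore replaced by functions that choose a chain for every cover, which do, and the classes are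
  recovered modulo the functions with values in the boundaries (\<open>null_reps\<close>).
\<close>

type_synonym ('a, 'f) thread_rep = "'a set set \<Rightarrow> ('a set, 'f) chain"

definition rep_scale :: "'f::field \<Rightarrow> ('a, 'f) thread_rep \<Rightarrow> ('a, 'f) thread_rep" where
  "rep_scale a r = (\<lambda>\<U>. chain_scale a (r \<U>))"

interpretation rep: vector_space "rep_scale :: 'f::field \<Rightarrow> ('a, 'f) thread_rep \<Rightarrow> ('a, 'f) thread_rep"
  by unfold_locales
    (auto simp: rep_scale_def fun_eq_iff chain.scale_right_distrib chain.scale_left_distrib)

interpretation rep_pair: vector_space_pair
  "rep_scale :: 'f::field \<Rightarrow> ('a, 'f) thread_rep \<Rightarrow> ('a, 'f) thread_rep"
  "rep_scale :: 'f::field \<Rightarrow> ('a, 'f) thread_rep \<Rightarrow> ('a, 'f) thread_rep"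
  by unfold_locales

definition thread_reps :: "int \<Rightarrow> 'a topology \<Rightarrow> ('a, 'f::field) thread_rep set" where
  "thread_reps k X =
     {r. (\<forall>\<U>\<in>open_covers X. r \<U> \<in> cycles k (nerve \<U>)) \<and>
         (\<forall>\<U>\<in>open_covers X. \<forall>\<V>\<in>open_covers X. \<forall>p. refinement_projection \<U> \<V> p \<longrightarrow>
            chain_map p (r \<U>) - r \<V> \<in> boundaries k (nerve \<V>))}"

definition null_reps :: "int \<Rightarrow> 'a topology \<Rightarrow> ('a, 'f::field) thread_rep set" where
  "null_reps k X = {r. \<forall>\<U>\<in>open_covers X. r \<U> \<in> boundaries k (nerve \<U>)}"

definition thread_of :: "int \<Rightarrow> 'a topology \<Rightarrow> ('a, 'f::field) thread_rep \<Rightarrow> ('a, 'f) thread" where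
  "thread_of k X r = (\<lambda>\<U> \<in> open_covers X. (+) (r \<U>) ` boundaries k (nerve \<U>))"

lemma thread_of_eq_iff: "thread_of k X r = thread_of k X r' \<longleftrightarrow> r - r' \<in> null_reps k X"
proof -
  have "thread_of k X r = thread_of k X r' \<longleftrightarrow>
      (\<forall>\<U>\<in>open_covers X. (+) (r \<U>) ` boundaries k (nerve \<U>) = (+) (r' \<U>) ` boundaries k (nerve \<U>))"
    unfolding thread_of_def by (metis (no_types, lifting) restrict_apply' restrict_ext)
  then show ?thesis by (simp add: null_reps_def coset_boundaries_eq_iff)
qed

lemma cech_homology_eq: "cech_homology k X = thread_of k X ` thread_reps k X"
proof (intro equalityI subsetI)
  fix x :: "('a, 'f::field) thread" assume "x \<in> cech_homology k X"
  then have x: "x \<in> (\<Pi>\<^sub>E \<U> \<in> open_covers X. homology k (nerve \<U>))"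
    and compat: "\<And>\<U> \<V> p. \<U> \<in> open_covers X \<Longrightarrow> \<V> \<in> open_covers X \<Longrightarrow>
      refinement_projection \<U> \<V> p \<Longrightarrow> homology_map k (nerve \<V>) p (x \<U>) = x \<V>"
    by (auto simp: cech_homology_def)
  have "\<forall>\<U>\<in>open_covers X. \<exists>z. z \<in> cycles k (nerve \<U>) \<and> x \<U> = (+) z ` boundaries k (nerve \<U>)"
    using x by (fastforce simp: homology_def PiE_iff)
  then obtain r where r: "\<And>\<U>. \<U> \<in> open_covers X \<Longrightarrow> r \<U> \<in> cycles k (nerve \<U>)"
      "\<And>\<U>. \<U> \<in> open_covers X \<Longrightarrow> x \<U> = (+) (r \<U>) ` boundaries k (nerve \<U>)"
    by metis
  have "chain_map p (r \<U>) - r \<V> \<in> boundaries k (nerve \<V>)"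
    if "\<U> \<in> open_covers X" "\<V> \<in> open_covers X" "refinement_projection \<U> \<V> p" for \<U> \<V> p
    using compat[OF that] r(2)[OF that(1)] r(2)[OF that(2)] that(3)
    by (simp add: projection_coset[OF that(3) that(3)] coset_boundaries_eq_iff)
  then have "r \<in> thread_reps k X" using r(1) by (simp add: thread_reps_def)
  moreover have "x = thread_of k X r"
    using x r(2) by (auto simp: thread_of_def fun_eq_iff PiE_iff extensional_def)
  ultimately show "x \<in> thread_of k X ` thread_reps k X" by blast
next
  fix x :: "('a, 'f::field) thread" assume "x \<in> thread_of k X ` thread_reps k X"
  then obtain r where r: "r \<in> thread_reps k X" "x = thread_of k X r" by blast
  have "homology_map k (nerve \<V>) p (x \<U>) = x \<V>"
    if "\<U> \<in> open_covers X" "\<V> \<in> open_covers X" "refinement_projection \<U> \<V> p" for \<U> \<V> p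
    using that r by (simp add: thread_of_def thread_reps_def projection_coset[OF that(3) that(3)]
        coset_boundaries_eq_iff)
  moreover have "x \<in> (\<Pi>\<^sub>E \<U> \<in> open_covers X. homology k (nerve \<U>))"
    unfolding r(2) thread_of_def
    using r(1) by (intro restrict_PiE_iff[THEN iffD2] ballI) (simp add: thread_reps_def homology_def)
  ultimately show "x \<in> cech_homology k X"
    by (simp add: cech_homology_def)
qed

definition trace_projection :: "'a topology \<Rightarrow> 'a set set \<Rightarrow> 'a set \<Rightarrow> 'a set" where
  "trace_projection X \<V> = (SOME p. refinement_projection (cover_trace X \<V>) \<V> p)"

lemma refinement_projection_trace: "refinement_projection (cover_trace X \<V>) \<V> (trace_projection X \<V>)"
proof -
  have "\<forall>U\<in>cover_trace X \<V>. \<exists>V. V \<in> \<V> \<and> U \<subseteq> V" by (auto simp: cover_trace_def)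
  then have "\<exists>p. refinement_projection (cover_trace X \<V>) \<V> p"
    unfolding refinement_projection_def by metis
  then show ?thesis unfolding trace_projection_def by (rule someI_ex)
qed

text \<open>
  The inclusion map on representatives. It does not depend on the larger space, only on the covers at
  which the result is evaluated.
\<close>

definition extend_rep :: "'a topology \<Rightarrow> ('a, 'f::field) thread_rep \<Rightarrow> ('a, 'f) thread_rep" where
  "extend_rep X r = (\<lambda>\<V>. chain_map (trace_projection X \<V>) (r (cover_trace X \<V>)))"

lemma linear_extend_rep:
  "Vector_Spaces.linear rep_scale rep_scale (extend_rep X :: ('a, 'f::field) thread_rep \<Rightarrow> _)"
  unfolding Vector_Spaces.linear_iff using rep.vector_space_axioms
  by (simp add: extend_rep_def fun_eq_iff rep_scale_def chain_map_add
       chain_pair.linear_scale[OF chain_linear_chain_map])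

lemma cover_trace_in_open_covers:
  assumes "continuous_map X Y (\<lambda>x. x)" "\<V> \<in> open_covers Y"
  shows "cover_trace X \<V> \<in> open_covers X"
proof -
  have "openin X (topspace X \<inter> V)" if "openin Y V" for V
    using openin_continuous_map_preimage[OF assms(1) that] by (simp add: Int_def)
  moreover have "topspace X \<subseteq> topspace Y"
    using assms(1) by (auto simp: continuous_map_def)
  ultimately show ?thesis
    using assms(2) by (auto simp: open_covers_def cover_trace_def)
qed

lemma cech_inclusion_thread_of:
  assumes "continuous_map X Y (\<lambda>x. x)"
  shows "cech_inclusion k X Y (thread_of k X r) = thread_of k Y (extend_rep X r)"
proof
  fix \<V>
  show "cech_inclusion k X Y (thread_of k X r) \<V> = thread_of k Y (extend_rep X r) \<V>"
  proof (cases "\<V> \<in> open_covers Y")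
    case True
    have "homology_map k (nerve \<V>) (trace_projection X \<V>) ((+) z ` boundaries k (nerve (cover_trace X \<V>))) =
        (+) (chain_map (trace_projection X \<V>) z) ` boundaries k (nerve \<V>)" for z :: "('a set, 'b) chain"
      by (rule projection_coset[OF refinement_projection_trace refinement_projection_trace])
    then show ?thesis
      using True cover_trace_in_open_covers[OF assms True]
      by (simp add: cech_inclusion_def thread_of_def extend_rep_def flip: trace_projection_def)
  qed (simp add: cech_inclusion_def thread_of_def)
qed

lemma extend_null_rep:
  assumes "continuous_map X Y (\<lambda>x. x)" "r \<in> null_reps k X"
  shows "extend_rep X r \<in> null_reps k Y"
  unfolding null_reps_def
proof (intro CollectI ballI)
  fix \<V> assume "\<V> \<in> open_covers Y"
  then have "r (cover_trace X \<V>) \<in> boundaries k (nerve (cover_trace X \<V>))"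
    using assms(2) cover_trace_in_open_covers[OF assms(1)] by (simp add: null_reps_def)
  then show "extend_rep X r \<V> \<in> boundaries k (nerve \<V>)"
    unfolding extend_rep_def
    by (rule projection_in_boundaries[OF refinement_projection_trace refinement_projection_trace])
qed

text \<open>
  For a refinement of covers of \<open>Y\<close>, the traces on \<open>X\<close> refine each other as well, by some \<open>q\<close>. The two
  ways around the resulting square of covers are refinement projections, hence agree in homology,
  and along \<open>q\<close> the representative is compatible.
\<close>

lemma extend_rep_in_thread_reps:
  assumes "continuous_map X Y (\<lambda>x. x)" and r: "r \<in> thread_reps k X"
  shows "extend_rep X r \<in> thread_reps k Y"
proof -
  note trace = cover_trace_in_open_covers[OF assms(1)]
  have cycles: "r (cover_trace X \<U>) \<in> cycles k (nerve (cover_trace X \<U>))" if "\<U> \<in> open_covers Y" for \<U>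
    using r trace[OF that] by (auto simp: thread_reps_def)
  have "chain_map p (extend_rep X r \<U>) - extend_rep X r \<V> \<in> boundaries k (nerve \<V>)"
    if U: "\<U> \<in> open_covers Y" and V: "\<V> \<in> open_covers Y" and p: "refinement_projection \<U> \<V> p" for \<U> \<V> p
  proof -
    have "\<exists>W. W \<in> cover_trace X \<V> \<and> U \<subseteq> W" if trace_U: "U \<in> cover_trace X \<U>" for U
    proof -
      obtain U' where "U' \<in> \<U>" "U = topspace X \<inter> U'" using trace_U by (auto simp: cover_trace_def)
      moreover from this have "p U' \<in> \<V>" "U' \<subseteq> p U'" using p by (auto simp: refinement_projection_def)
      ultimately show ?thesis
        by (intro exI[of _ "topspace X \<inter> p U'"]) (auto simp: cover_trace_def)
    qed
    then obtain q where q: "refinement_projection (cover_trace X \<U>) (cover_trace X \<V>) q"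
      unfolding refinement_projection_def by metis
    let ?t = "\<lambda>\<W>. trace_projection X \<W>" and ?r = "\<lambda>\<W>. r (cover_trace X \<W>)"
    have "chain_map (p \<circ> ?t \<U>) (?r \<U>) - chain_map (?t \<V> \<circ> q) (?r \<U>) \<in> boundaries k (nerve \<V>)"
      by (intro projections_homologous[OF _ _ cycles[OF U]] refinement_projection_compose[OF q]
          refinement_projection_compose[OF refinement_projection_trace p] refinement_projection_trace)
    moreover have "chain_map q (?r \<U>) - ?r \<V> \<in> boundaries k (nerve (cover_trace X \<V>))"
      using r trace[OF U] trace[OF V] q by (auto simp: thread_reps_def)
    then have "chain_map (?t \<V>) (chain_map q (?r \<U>) - ?r \<V>) \<in> boundaries k (nerve \<V>)"
      by (rule projection_in_boundaries[OF refinement_projection_trace refinement_projection_trace])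
    ultimately have "(chain_map (p \<circ> ?t \<U>) (?r \<U>) - chain_map (?t \<V> \<circ> q) (?r \<U>)) +
        chain_map (?t \<V>) (chain_map q (?r \<U>) - ?r \<V>) \<in> boundaries k (nerve \<V>)"
      by (rule chain.subspace_add[OF subspace_boundaries])
    then show ?thesis
      by (simp add: extend_rep_def chain_map_compose chain_map_diff)
  qed
  moreover have "extend_rep X r \<U> \<in> cycles k (nerve \<U>)" if "\<U> \<in> open_covers Y" for \<U>
    unfolding extend_rep_def
    by (rule projection_in_cycles[OF refinement_projection_trace refinement_projection_trace cycles[OF that]])
  ultimately show ?thesis by (simp add: thread_reps_def)
qed

text \<open>
  Functoriality. The traces on \<open>X\<close> of a cover of \<open>Z\<close> can be taken in one step or through \<open>Y\<close>; the
  chosen projections may differ, but only up to homology.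
\<close>

lemma extend_rep_compose:
  assumes XY: "continuous_map X Y (\<lambda>x. x)" and YZ: "continuous_map Y Z (\<lambda>x. x)"
    and r: "r \<in> thread_reps k X"
  shows "extend_rep Y (extend_rep X r) - extend_rep X r \<in> null_reps k Z"
  unfolding null_reps_def
proof (intro CollectI ballI)
  fix \<W> assume W: "\<W> \<in> open_covers Z"
  have trace: "cover_trace X (cover_trace Y \<W>) = cover_trace X \<W>"
    using XY by (auto simp: cover_trace_def image_image continuous_map_def intro!: image_cong)
  have "cover_trace X \<W> \<in> open_covers X"
    using cover_trace_in_open_covers continuous_map_compose[OF XY YZ] W by (simp add: o_def)
  then have "r (cover_trace X \<W>) \<in> cycles k (nerve (cover_trace X \<W>))"
    using r by (auto simp: thread_reps_def)
  moreover have "refinement_projection (cover_trace X \<W>) \<W>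
      (trace_projection Y \<W> \<circ> trace_projection X (cover_trace Y \<W>))"
    using refinement_projection_compose[OF refinement_projection_trace refinement_projection_trace]
    by (metis trace)
  ultimately have "chain_map (trace_projection Y \<W> \<circ> trace_projection X (cover_trace Y \<W>)) (r (cover_trace X \<W>)) -
      chain_map (trace_projection X \<W>) (r (cover_trace X \<W>)) \<in> boundaries k (nerve \<W>)"
    by (intro projections_homologous[OF refinement_projection_trace])
  then show "(extend_rep Y (extend_rep X r) - extend_rep X r) \<W> \<in> boundaries k (nerve \<W>)"
    by (simp add: extend_rep_def trace chain_map_compose)
qed

section \<open>Dimensions and ranks of inclusions\<close>

text \<open>
  Dimension with values in \<open>enat\<close>, in the same form as \<open>cech_dim\<close>. It is \<open>\<infinity>\<close> on infinite-dimensional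
  spaces, where \<open>dim\<close> carries no information.
\<close>

definition (in vector_space) ext_dim :: "'b set \<Rightarrow> enat" where
  "ext_dim V = Sup {enat (card S) | S. S \<subseteq> V \<and> finite S \<and> independent S}"

lemma (in vector_space) ext_dim_upper:
  assumes "S \<subseteq> V" "finite S" "independent S"
  shows "enat (card S) \<le> ext_dim V"
  unfolding ext_dim_def by (rule Sup_upper) (use assms in blast)

lemma (in vector_space) ext_dim_le_card:
  assumes "finite T" "V \<subseteq> span T"
  shows "ext_dim V \<le> enat (card T)"
  unfolding ext_dim_def
proof (rule Sup_least)
  fix d assume "d \<in> {enat (card S) | S. S \<subseteq> V \<and> finite S \<and> independent S}"
  then obtain S where S: "d = enat (card S)" "S \<subseteq> V" "independent S" by blast
  with assms(2) have "S \<subseteq> span T" by blast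
  then show "d \<le> enat (card T)"
    using independent_span_bound[OF assms(1) S(3)] S(1) by simp
qed

lemma (in vector_space) ext_dim_eq_card:
  assumes "independent T" "finite T" "T \<subseteq> V" "V \<subseteq> span T"
  shows "ext_dim V = enat (card T)"
  using ext_dim_upper[of T V] ext_dim_le_card[of T V] assms by (simp add: antisym)

lemma (in vector_space) finite_if_ext_dim_finite:
  assumes "ext_dim V \<noteq> \<infinity>" "S \<subseteq> V" "independent S"
  shows "finite S"
proof (rule ccontr)
  assume inf: "infinite S"
  obtain n where n: "ext_dim V = enat n" using assms(1) by auto
  obtain T where T: "T \<subseteq> S" "finite T" "card T = Suc n"
    using infinite_arbitrarily_large[OF inf] by metis
  then have "enat (Suc n) \<le> ext_dim V"
    using ext_dim_upper[of T V] assms independent_mono[OF assms(3) T(1)] by auto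
  with n show False by simp
qed

lemma (in vector_space) ext_dim_mono: "V \<subseteq> W \<Longrightarrow> ext_dim V \<le> ext_dim W"
  unfolding ext_dim_def by (rule Sup_subset_mono) blast

text \<open>
  If \<open>C\<close> is a basis of \<open>W\<close> that extends a basis \<open>B\<close> of \<open>V\<close>, then \<open>f ` W\<close> is spanned by a basis of \<open>f ` V\<close>
  together with the images of the \<open>dim W - dim V\<close> vectors of \<open>C - B\<close>. When \<open>dim W\<close> is infinite, the right
  side is \<open>\<infinity>\<close>, also if \<open>dim V\<close> is infinite, by the convention \<open>\<infinity> - \<infinity> = \<infinity>\<close> of \<open>ereal\<close>.
\<close>

lemma (in vector_space) ext_dim_image_diff_le:
  assumes f: "Vector_Spaces.linear scale scale f"
    and V: "V \<subseteq> W"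
  shows "ereal_of_enat (ext_dim (f ` W)) - ereal_of_enat (ext_dim (f ` V))
       \<le> ereal_of_enat (ext_dim W) - ereal_of_enat (ext_dim V)"
proof (cases "ext_dim W = \<infinity>")
  case True
  then show ?thesis by (cases "ext_dim V") auto
next
  case False
  interpret f: Vector_Spaces.linear scale scale f by fact
  obtain B where B: "B \<subseteq> V" "independent B" "V \<subseteq> span B"
    using maximal_independent_subset by blast
  obtain C where C: "B \<subseteq> C" "C \<subseteq> W" "independent C" "W \<subseteq> span C"
    using maximal_independent_subset_extend[of B W] B V by blast
  have fin: "finite C" "finite B"
    using finite_if_ext_dim_finite[OF False] C finite_subset by blast+
  obtain E where E: "E \<subseteq> f ` V" "independent E" "f ` V \<subseteq> span E"
    using maximal_independent_subset by blast
  have "f ` V \<subseteq> span (f ` B)" using B(3) f.span_image by blast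
  then have finE: "finite E"
    using independent_span_bound[of "f ` B" E] E fin by auto
  have "f ` C \<subseteq> span (E \<union> f ` (C - B))"
  proof
    fix y assume "y \<in> f ` C"
    then obtain x where x: "x \<in> C" "y = f x" by blast
    show "y \<in> span (E \<union> f ` (C - B))"
    proof (cases "x \<in> B")
      case True
      then have "y \<in> span E" using x B(1) E(3) by blast
      then show ?thesis using span_mono[of E "E \<union> f ` (C - B)"] by blast
    next
      case False
      then show ?thesis using x by (intro span_base) blast
    qed
  qed
  then have "span (f ` C) \<subseteq> span (E \<union> f ` (C - B))"
    by (rule span_minimal) simp
  then have "f ` W \<subseteq> span (E \<union> f ` (C - B))"
    using C(4) f.span_image[of C] by blast
  then have "ext_dim (f ` W) \<le> enat (card (E \<union> f ` (C - B)))"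
    using ext_dim_le_card fin finE by simp
  also have "card (E \<union> f ` (C - B)) \<le> card E + card (C - B)"
    using card_Un_le[of E "f ` (C - B)"] card_image_le[of "C - B" f] fin by simp
  finally obtain d where d: "ext_dim (f ` W) = enat d" "d \<le> card E + card (C - B)"
    by (cases "ext_dim (f ` W)") auto
  have "ext_dim W = enat (card C)" "ext_dim V = enat (card B)" "ext_dim (f ` V) = enat (card E)"
    using ext_dim_eq_card B C E fin finE by auto
  moreover have "card (C - B) = card C - card B" "card B \<le> card C"
    using C(1) fin by (simp_all add: card_Diff_subset card_mono)
  ultimately show ?thesis using d by simp
qed

text \<open>
  A projection along \<open>Z\<close> onto a complement: its image is a copy of the quotient by \<open>Z\<close> inside the given
  space.
\<close>

lemma (in vector_space) exists_linear_with_kernel: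
  assumes "subspace Z"
  obtains f where "Vector_Spaces.linear scale scale f" "\<And>x. x - f x \<in> Z" "\<And>x. f x = 0 \<longleftrightarrow> x \<in> Z"
proof -
  interpret vector_space_pair scale scale by unfold_locales
  obtain g where g: "range g \<subseteq> Z" "Vector_Spaces.linear scale scale g" "\<forall>x\<in>Z. g x = x"
    using linear_exists_left_inverse_on[OF linear_id assms] by auto
  show thesis
  proof
    show "Vector_Spaces.linear scale scale (\<lambda>x. x - g x)"
      by (intro linear_compose_sub linear_ident g)
    show "x - (x - g x) \<in> Z" for x using g(1) by auto
    show "x - g x = 0 \<longleftrightarrow> x \<in> Z" for x
      using g(1,3) by (metis eq_iff_diff_eq_0 rangeI subsetD)
  qed
qed

lemma subspace_null_reps: "rep.subspace (null_reps k X :: ('a, 'f::field) thread_rep set)"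
  by (rule rep.subspaceI)
    (auto simp: null_reps_def rep_scale_def chain.subspace_0 chain.subspace_add
       chain.subspace_scale subspace_boundaries)

lemma homology_lincomb_cosets:
  assumes I: "finite I"
  shows "homology_lincomb k N I a (\<lambda>i. (+) (z i) ` boundaries k N) =
     (+) (\<Sum>i\<in>I. chain_scale (a i) (z i)) ` boundaries k N"
proof (intro equalityI subsetI)
  fix t assume "t \<in> homology_lincomb k N I a (\<lambda>i. (+) (z i) ` boundaries k N)"
  then obtain y b where y: "\<forall>i\<in>I. y i \<in> (+) (z i) ` boundaries k N" and b: "b \<in> boundaries k N"
      and t: "t = (\<Sum>i\<in>I. chain_scale (a i) (y i)) + b"
    by (auto simp: homology_lincomb_def)
  have "(\<Sum>i\<in>I. chain_scale (a i) (y i - z i)) + b \<in> boundaries k N"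
  proof (intro chain.subspace_add[OF subspace_boundaries _ b] chain.subspace_sum[OF subspace_boundaries]
      chain.subspace_scale[OF subspace_boundaries])
    fix i assume "i \<in> I"
    then show "y i - z i \<in> boundaries k N" using y by fastforce
  qed
  moreover have "t = (\<Sum>i\<in>I. chain_scale (a i) (z i)) + ((\<Sum>i\<in>I. chain_scale (a i) (y i - z i)) + b)"
    by (simp add: t chain.scale_right_diff_distrib sum_subtractf)
  ultimately show "t \<in> (+) (\<Sum>i\<in>I. chain_scale (a i) (z i)) ` boundaries k N" by blast
next
  fix t assume "t \<in> (+) (\<Sum>i\<in>I. chain_scale (a i) (z i)) ` boundaries k N"
  moreover have "z i \<in> (+) (z i) ` boundaries k N" for i
    using chain.subspace_0[OF subspace_boundaries] by (metis add_0_right imageI)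
  ultimately show "t \<in> homology_lincomb k N I a (\<lambda>i. (+) (z i) ` boundaries k N)"
    unfolding homology_lincomb_def by blast
qed

lemma homology_lincomb_reindex:
  assumes "inj_on g I"
  shows "homology_lincomb k N (g ` I) a h = homology_lincomb k N I (a \<circ> g) (h \<circ> g)"
proof (intro equalityI subsetI)
  fix t assume "t \<in> homology_lincomb k N (g ` I) a h"
  then obtain z b where z: "\<forall>i\<in>g ` I. z i \<in> h i" and b: "b \<in> boundaries k N"
      and t: "t = (\<Sum>i\<in>g ` I. chain_scale (a i) (z i)) + b"
    unfolding homology_lincomb_def by blast
  have "t = (\<Sum>i\<in>I. chain_scale ((a \<circ> g) i) ((z \<circ> g) i)) + b"
    by (simp add: t sum.reindex[OF assms])
  moreover have "\<forall>i\<in>I. (z \<circ> g) i \<in> (h \<circ> g) i" using z by simp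
  ultimately show "t \<in> homology_lincomb k N I (a \<circ> g) (h \<circ> g)"
    unfolding homology_lincomb_def using b by blast
next
  fix t assume "t \<in> homology_lincomb k N I (a \<circ> g) (h \<circ> g)"
  then obtain z b where z: "\<forall>i\<in>I. z i \<in> (h \<circ> g) i" and b: "b \<in> boundaries k N"
      and t: "t = (\<Sum>i\<in>I. chain_scale ((a \<circ> g) i) (z i)) + b"
    unfolding homology_lincomb_def by blast
  let ?z = "z \<circ> inv_into I g"
  have "t = (\<Sum>i\<in>g ` I. chain_scale (a i) (?z i)) + b"
    using assms by (simp add: t sum.reindex)
  moreover have "\<forall>i\<in>g ` I. ?z i \<in> h i" using z assms by simp
  ultimately show "t \<in> homology_lincomb k N (g ` I) a h"
    unfolding homology_lincomb_def using b by blast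
qed

text \<open>
  Along an injective \<open>g\<close>, every family of coefficients on \<open>Q\<close> is the pullback of one on \<open>g ` Q\<close>.
\<close>

lemma coefficients_reindex:
  assumes "inj_on g Q"
  shows "(\<forall>a. (\<Sum>r\<in>Q. s (a (g r)) r) = 0 \<longrightarrow> (\<forall>r\<in>Q. a (g r) = 0)) \<longleftrightarrow>
     (\<forall>c. (\<Sum>r\<in>Q. s (c r) r) = 0 \<longrightarrow> (\<forall>r\<in>Q. c r = 0))" (is "?L \<longleftrightarrow> ?R")
proof
  assume L: ?L
  show ?R
  proof (intro allI impI)
    fix c assume "(\<Sum>r\<in>Q. s (c r) r) = 0"
    moreover have "(c \<circ> inv_into Q g) (g r) = c r" if "r \<in> Q" for r
      using that assms by simp
    ultimately show "\<forall>r\<in>Q. c r = 0"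
      using L[rule_format, of "c \<circ> inv_into Q g"] by (simp cong: sum.cong)
  qed
next
  assume ?R
  then show ?L by (auto dest: spec[of _ "\<lambda>r. _ (g r)"])
qed

lemma sum_fun_apply: "sum f A x = (\<Sum>i\<in>A. f i x)"
  by (induction A rule: infinite_finite_induct) auto

lemma cech_lincomb_thread_of:
  assumes "finite Q" "inj_on (thread_of k X) Q"
  shows "cech_lincomb k X (thread_of k X ` Q) a =
     thread_of k X (\<Sum>r\<in>Q. rep_scale (a (thread_of k X r)) r)"
proof
  fix \<U>
  show "cech_lincomb k X (thread_of k X ` Q) a \<U> = thread_of k X (\<Sum>r\<in>Q. rep_scale (a (thread_of k X r)) r) \<U>"
  proof (cases "\<U> \<in> open_covers X")
    case True
    have "cech_lincomb k X (thread_of k X ` Q) a \<U> =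
        homology_lincomb k (nerve \<U>) Q (a \<circ> thread_of k X) (\<lambda>r. (+) (r \<U>) ` boundaries k (nerve \<U>))"
      using True homology_lincomb_reindex[OF assms(2), of k "nerve \<U>" a "\<lambda>x. x \<U>"]
      by (simp add: cech_lincomb_def o_def) (simp add: thread_of_def)
    also have "\<dots> = thread_of k X (\<Sum>r\<in>Q. rep_scale (a (thread_of k X r)) r) \<U>"
      using True by (simp add: homology_lincomb_cosets[OF assms(1)] thread_of_def sum_fun_apply rep_scale_def)
    finally show ?thesis .
  qed (simp add: cech_lincomb_def thread_of_def)
qed

lemma cech_zero_eq: "cech_zero k X = thread_of k X 0"
  by (simp add: cech_zero_def thread_of_def)

text \<open>
  Such an \<open>f\<close> picks one vector for each thread: \<open>f r\<close> represents the same thread as \<open>r\<close>, and two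
  representatives have the same image exactly if they define the same thread.
\<close>

definition collapses_null_reps ::
    "int \<Rightarrow> 'a topology \<Rightarrow> (('a, 'f::field) thread_rep \<Rightarrow> ('a, 'f) thread_rep) \<Rightarrow> bool" where
  "collapses_null_reps k X f \<longleftrightarrow> Vector_Spaces.linear rep_scale rep_scale f \<and>
     (\<forall>r. r - f r \<in> null_reps k X) \<and> (\<forall>r. f r = 0 \<longleftrightarrow> r \<in> null_reps k X)"

lemma collapse_eq_iff:
  assumes "collapses_null_reps k X f"
  shows "f r = f r' \<longleftrightarrow> thread_of k X r = thread_of k X r'"
proof -
  interpret f: Vector_Spaces.linear rep_scale rep_scale f
    using assms by (simp add: collapses_null_reps_def)
  have "f r = f r' \<longleftrightarrow> f (r - r') = 0" by (simp add: f.diff)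
  then show ?thesis using assms by (simp add: collapses_null_reps_def thread_of_eq_iff)
qed

lemma cech_independent_iff:
  fixes f :: "('a, 'f::field) thread_rep \<Rightarrow> ('a, 'f) thread_rep"
  assumes f: "collapses_null_reps k X f" and Q: "finite Q" "inj_on f Q"
  shows "cech_independent k X (thread_of k X ` Q) \<longleftrightarrow> \<not> rep.dependent (f ` Q)"
proof -
  interpret f: Vector_Spaces.linear rep_scale rep_scale f
    using f by (simp add: collapses_null_reps_def)
  have inj: "inj_on (thread_of k X) Q"
    using Q(2) by (simp add: inj_on_def collapse_eq_iff[OF f])
  have "cech_lincomb k X (thread_of k X ` Q) a = cech_zero k X \<longleftrightarrow>
      (\<Sum>r\<in>Q. rep_scale (a (thread_of k X r)) (f r)) = 0" for a
    by (simp add: cech_lincomb_thread_of[OF Q(1) inj] cech_zero_eq f.zero f.sum f.scale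
        flip: collapse_eq_iff[OF f])
  then have "cech_independent k X (thread_of k X ` Q) \<longleftrightarrow>
      (\<forall>a. (\<Sum>r\<in>Q. rep_scale (a (thread_of k X r)) (f r)) = 0 \<longrightarrow> (\<forall>r\<in>Q. a (thread_of k X r) = 0))"
    by (simp add: cech_independent_def)
  also have "\<dots> \<longleftrightarrow> (\<forall>a. (\<Sum>r\<in>Q. rep_scale (a (f r)) (f r)) = 0 \<longrightarrow> (\<forall>r\<in>Q. a (f r) = 0))"
    by (simp only: coefficients_reindex[OF inj, where s = "\<lambda>c r. rep_scale c (f r)"]
        coefficients_reindex[OF Q(2), where s = "\<lambda>c r. rep_scale c (f r)"])
  also have "\<dots> \<longleftrightarrow> \<not> rep.dependent (f ` Q)"
    using Q by (auto simp: rep.dependent_finite sum.reindex)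
  finally show ?thesis .
qed

text \<open>
  Independent sets on both sides are images of the same sets of representatives, since \<open>f\<close> and
  \<open>thread_of k X\<close> identify the same ones.
\<close>

lemma cech_dim_eq:
  fixes f :: "('a, 'f::field) thread_rep \<Rightarrow> ('a, 'f) thread_rep"
  assumes f: "collapses_null_reps k X f"
  shows "cech_dim k X (thread_of k X ` R) = rep.ext_dim (f ` R)"
proof -
  have inj: "inj_on f Q \<longleftrightarrow> inj_on (thread_of k X) Q" for Q
    by (simp add: inj_on_def collapse_eq_iff[OF f])
  have "(\<exists>S. S \<subseteq> thread_of k X ` R \<and> finite S \<and> cech_independent k X S \<and> n = card S) \<longleftrightarrow>
        (\<exists>S. S \<subseteq> f ` R \<and> finite S \<and> \<not> rep.dependent S \<and> n = card S)" for n
  proof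
    assume "\<exists>S. S \<subseteq> thread_of k X ` R \<and> finite S \<and> cech_independent k X S \<and> n = card S"
    then obtain S where S: "S \<subseteq> thread_of k X ` R" "finite S" "cech_independent k X S" "n = card S"
      by blast
    then obtain Q where Q: "Q \<subseteq> R" "inj_on (thread_of k X) Q" "S = thread_of k X ` Q"
      unfolding subset_image_inj by blast
    then have "finite Q" using S(2) finite_imageD by blast
    then show "\<exists>S. S \<subseteq> f ` R \<and> finite S \<and> \<not> rep.dependent S \<and> n = card S"
      using Q S cech_independent_iff[OF f, of Q]
      by (intro exI[of _ "f ` Q"]) (auto simp: inj card_image)
  next
    assume "\<exists>S. S \<subseteq> f ` R \<and> finite S \<and> \<not> rep.dependent S \<and> n = card S"
    then obtain S where S: "S \<subseteq> f ` R" "finite S" "\<not> rep.dependent S" "n = card S"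
      by blast
    then obtain Q where Q: "Q \<subseteq> R" "inj_on f Q" "S = f ` Q"
      unfolding subset_image_inj by blast
    then have "finite Q" using S(2) finite_imageD by blast
    then show "\<exists>S. S \<subseteq> thread_of k X ` R \<and> finite S \<and> cech_independent k X S \<and> n = card S"
      using Q S cech_independent_iff[OF f, of Q]
      by (intro exI[of _ "thread_of k X ` Q"]) (auto simp: inj card_image)
  qed
  then have "{enat (card S) | S. S \<subseteq> thread_of k X ` R \<and> finite S \<and> cech_independent k X S} =
      {enat (card S) | S. S \<subseteq> f ` R \<and> finite S \<and> \<not> rep.dependent S}"
    by (simp add: set_eq_iff) metis
  then show ?thesis by (simp add: cech_dim_def rep.ext_dim_def)
qed

definition inclusion_rank :: "'f::field itself \<Rightarrow> int \<Rightarrow> 'a topology \<Rightarrow> 'a topology \<Rightarrow> enat" where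
  "inclusion_rank F k X Y =
     cech_dim k Y (cech_inclusion k X Y ` (cech_homology k X :: ('a, 'f) thread set))"

lemma inclusion_rank_eq:
  fixes f :: "('a, 'f::field) thread_rep \<Rightarrow> ('a, 'f) thread_rep"
  assumes f: "collapses_null_reps k Y f" and "continuous_map X Y (\<lambda>x. x)"
  shows "inclusion_rank TYPE('f) k X Y = rep.ext_dim (f ` extend_rep X ` thread_reps k X)"
  using cech_dim_eq[OF f, of "extend_rep X ` thread_reps k X"]
  by (simp add: inclusion_rank_def cech_homology_eq image_image cech_inclusion_thread_of[OF assms(2)])

lemma collapse_exists:
  obtains f :: "('a, 'f::field) thread_rep \<Rightarrow> ('a, 'f) thread_rep" where "collapses_null_reps k X f"
  using rep.exists_linear_with_kernel[OF subspace_null_reps[of k X]] unfolding collapses_null_reps_def by metis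

text \<open>
  By functoriality, a class coming from \<open>X\<close> also comes from \<open>Y\<close>.
\<close>

lemma extend_images_mono:
  fixes f :: "('a, 'f::field) thread_rep \<Rightarrow> ('a, 'f) thread_rep"
  assumes f: "collapses_null_reps k Z f"
    and XY: "continuous_map X Y (\<lambda>x. x)" and YZ: "continuous_map Y Z (\<lambda>x. x)"
  shows "f ` extend_rep X ` thread_reps k X \<subseteq> f ` extend_rep Y ` thread_reps k Y"
proof -
  have "f (extend_rep X r) = f (extend_rep Y (extend_rep X r))" if "r \<in> thread_reps k X" for r
    using extend_rep_compose[OF XY YZ that] by (simp add: collapse_eq_iff[OF f] thread_of_eq_iff[symmetric])
  then show ?thesis using extend_rep_in_thread_reps[OF XY] by blast
qed

lemma inclusion_rank_mono:
  assumes "continuous_map X Y (\<lambda>x. x)" "continuous_map Y Z (\<lambda>x. x)"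
  shows "inclusion_rank TYPE('f::field) k X Z \<le> inclusion_rank TYPE('f) k Y Z"
proof -
  obtain f :: "('a, 'f) thread_rep \<Rightarrow> ('a, 'f) thread_rep" where f: "collapses_null_reps k Z f"
    using collapse_exists .
  have "continuous_map X Z (\<lambda>x. x)"
    using continuous_map_compose[OF assms] by (simp add: o_def)
  then show ?thesis
    using rep.ext_dim_mono[OF extend_images_mono[OF f assms]]
    by (simp add: inclusion_rank_eq[OF f] assms)
qed

text \<open>
  The images of the homology of \<open>A\<close> and \<open>B\<close> in that of \<open>C\<close> are nested, and by functoriality the
  map from \<open>C\<close> to \<open>D\<close> carries them to the corresponding images for \<open>D\<close>. So this is
  \<open>ext_dim_image_diff_le\<close>.
\<close>

lemma inclusion_rank_diff_antimono:
  assumes AB: "continuous_map A B (\<lambda>x. x)" and BC: "continuous_map B C (\<lambda>x. x)"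
    and CD: "continuous_map C D (\<lambda>x. x)"
  shows "ereal_of_enat (inclusion_rank TYPE('f::field) k B D) - ereal_of_enat (inclusion_rank TYPE('f) k A D)
     \<le> ereal_of_enat (inclusion_rank TYPE('f) k B C) - ereal_of_enat (inclusion_rank TYPE('f) k A C)"
proof -
  have AC: "continuous_map A C (\<lambda>x. x)" and BD: "continuous_map B D (\<lambda>x. x)"
    using continuous_map_compose[OF AB BC] continuous_map_compose[OF BC CD] by (simp_all add: o_def)
  have AD: "continuous_map A D (\<lambda>x. x)"
    using continuous_map_compose[OF AC CD] by (simp add: o_def)
  obtain f :: "('a, 'f) thread_rep \<Rightarrow> ('a, 'f) thread_rep" where f: "collapses_null_reps k C f"
    using collapse_exists .
  obtain g :: "('a, 'f) thread_rep \<Rightarrow> ('a, 'f) thread_rep" where g: "collapses_null_reps k D g"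
    using collapse_exists .
  \<comment> \<open>The map induced by the inclusion of \<open>C\<close> in \<open>D\<close>, on the vectors that stand for threads.\<close>
  let ?h = "g \<circ> extend_rep C"
  have h: "Vector_Spaces.linear rep_scale rep_scale ?h"
    using g by (intro Vector_Spaces.linear_compose[OF linear_extend_rep]) (simp add: collapses_null_reps_def)
  have image: "?h ` f ` extend_rep X ` thread_reps k X = g ` extend_rep X ` thread_reps k X"
    if XC: "continuous_map X C (\<lambda>x. x)" for X
  proof -
    interpret e: Vector_Spaces.linear rep_scale rep_scale "extend_rep C" by (rule linear_extend_rep)
    have "g (extend_rep C (f (extend_rep X r))) = g (extend_rep X r)" if "r \<in> thread_reps k X" for r
    proof -
      have "extend_rep C (extend_rep X r - f (extend_rep X r)) \<in> null_reps k D"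
        using f by (intro extend_null_rep[OF CD]) (simp add: collapses_null_reps_def)
      then have "g (extend_rep C (f (extend_rep X r))) = g (extend_rep C (extend_rep X r))"
        unfolding e.diff thread_of_eq_iff[symmetric] collapse_eq_iff[OF g] by simp
      also have "\<dots> = g (extend_rep X r)"
        using extend_rep_compose[OF XC CD that] by (simp add: collapse_eq_iff[OF g] thread_of_eq_iff)
      finally show ?thesis .
    qed
    then show ?thesis by (simp add: image_image)
  qed
  show ?thesis
    using rep.ext_dim_image_diff_le[OF h extend_images_mono[OF f AB BC]]
    by (simp only: inclusion_rank_eq[OF f AC] inclusion_rank_eq[OF f BC] inclusion_rank_eq[OF g AD]
        inclusion_rank_eq[OF g BD] image[OF AC] image[OF BC])
qed

section \<open>Persistence diagrams under affine reparametrization\<close>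

text \<open>
  The property of rank invariants that makes the multiplicity at infinity independent of the curve
  \<open>v = 1 / \<epsilon>\<close> used in its definition: the difference does not increase when the pair \<open>u\<^sub>1, u\<^sub>2\<close> shrinks and \<open>v\<close>
  grows.
\<close>

definition rank_differences_shrink :: "(real \<Rightarrow> real \<Rightarrow> enat) \<Rightarrow> bool" where
  "rank_differences_shrink \<rho> \<longleftrightarrow>
     (\<forall>u\<^sub>1 u\<^sub>1' u\<^sub>2' u\<^sub>2 v v'. u\<^sub>1 \<le> u\<^sub>1' \<longrightarrow> u\<^sub>1' \<le> u\<^sub>2' \<longrightarrow> u\<^sub>2' \<le> u\<^sub>2 \<longrightarrow> u\<^sub>2 \<le> v \<longrightarrow> v \<le> v' \<longrightarrow>
        ereal_of_enat (\<rho> u\<^sub>2' v') - ereal_of_enat (\<rho> u\<^sub>1' v')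
        \<le> ereal_of_enat (\<rho> u\<^sub>2 v) - ereal_of_enat (\<rho> u\<^sub>1 v))"

text \<open>
  Below any pair \<open>(\<epsilon>, v)\<close> the curve \<open>v = 1 / \<epsilon>\<close> has a point with smaller \<open>\<epsilon>\<close> and larger \<open>v\<close>, at which the
  difference is no larger.
\<close>

lemma multiplicity_infinity_eq:
  assumes "rank_differences_shrink \<rho>"
  shows "multiplicity_infinity \<rho> u =
     (INF (\<epsilon>, v) \<in> {(\<epsilon>, v). 0 < \<epsilon> \<and> u + \<epsilon> < v}.
        ereal_of_enat (\<rho> (u + \<epsilon>) v) - ereal_of_enat (\<rho> (u - \<epsilon>) v))"
proof (rule antisym)
  show "multiplicity_infinity \<rho> u \<le> (INF (\<epsilon>, v) \<in> {(\<epsilon>, v). 0 < \<epsilon> \<and> u + \<epsilon> < v}.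
        ereal_of_enat (\<rho> (u + \<epsilon>) v) - ereal_of_enat (\<rho> (u - \<epsilon>) v))"
  proof (intro INF_greatest, clarify)
    fix \<epsilon> v :: real assume \<epsilon>: "0 < \<epsilon>" "u + \<epsilon> < v"
    \<comment> \<open>Chosen so that \<open>\<delta> \<le> \<epsilon>\<close> and \<open>v \<le> 1 / \<delta>\<close>.\<close>
    define \<delta> where "\<delta> = min \<epsilon> (1 / (\<bar>v\<bar> + 1))"
    have \<delta>: "0 < \<delta>" "\<delta> \<le> \<epsilon>" using \<epsilon> by (auto simp: \<delta>_def)
    have "\<delta> \<le> 1 / (\<bar>v\<bar> + 1)" by (simp add: \<delta>_def)
    then have "\<bar>v\<bar> + 1 \<le> 1 / \<delta>" using \<delta>(1) by (simp add: field_simps)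
    then have v: "v \<le> 1 / \<delta>" by simp
    have "multiplicity_infinity \<rho> u \<le>
        ereal_of_enat (\<rho> (u + \<delta>) (1 / \<delta>)) - ereal_of_enat (\<rho> (u - \<delta>) (1 / \<delta>))"
      unfolding multiplicity_infinity_def using \<epsilon> \<delta> v by (intro INF_lower) auto
    also have "\<dots> \<le> ereal_of_enat (\<rho> (u + \<epsilon>) v) - ereal_of_enat (\<rho> (u - \<epsilon>) v)"
      using assms \<epsilon> \<delta> v unfolding rank_differences_shrink_def by simp
    finally show "multiplicity_infinity \<rho> u \<le>
        ereal_of_enat (\<rho> (u + \<epsilon>) v) - ereal_of_enat (\<rho> (u - \<epsilon>) v)" .
  qed
  show "(INF (\<epsilon>, v) \<in> {(\<epsilon>, v). 0 < \<epsilon> \<and> u + \<epsilon> < v}.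
        ereal_of_enat (\<rho> (u + \<epsilon>) v) - ereal_of_enat (\<rho> (u - \<epsilon>) v)) \<le> multiplicity_infinity \<rho> u"
    unfolding multiplicity_infinity_def
    by (rule INF_greatest, rule INF_lower2[where i = "(_, 1 / _)"]) auto
qed

definition affine_reparam :: "real \<Rightarrow> real \<Rightarrow> (real \<Rightarrow> real \<Rightarrow> enat) \<Rightarrow> real \<Rightarrow> real \<Rightarrow> enat" where
  "affine_reparam c d \<rho> u v = \<rho> (c * u + d) (c * v + d)"

lemma rank_differences_shrink_affine_reparam:
  assumes "rank_differences_shrink \<rho>" "0 < c"
  shows "rank_differences_shrink (affine_reparam c d \<rho>)"
  using assms unfolding rank_differences_shrink_def affine_reparam_def by simp

text \<open>
  In the form of \<open>multiplicity_infinity_eq\<close> the pairs \<open>(\<epsilon>, v)\<close> admitted for \<open>u\<close> correspond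
  to those admitted for \<open>c * u + d\<close>.
\<close>

lemma multiplicity_infinity_affine_reparam:
  assumes \<rho>: "rank_differences_shrink \<rho>" and c: "0 < c"
  shows "multiplicity_infinity (affine_reparam c d \<rho>) u = multiplicity_infinity \<rho> (c * u + d)"
proof -
  let ?A = "\<lambda>(\<epsilon>, v). (c * \<epsilon>, c * v + d)"
  have "{(\<epsilon>, v). 0 < \<epsilon> \<and> c * u + d + \<epsilon> < v} = ?A ` {(\<epsilon>, v). 0 < \<epsilon> \<and> u + \<epsilon> < v}"
  proof (intro equalityI subsetI)
    fix x assume "x \<in> {(\<epsilon>, v). 0 < \<epsilon> \<and> c * u + d + \<epsilon> < v}"
    then obtain \<epsilon> v where x: "x = (\<epsilon>, v)" "0 < \<epsilon>" "c * u + d + \<epsilon> < v" by auto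
    have "x = ?A (\<epsilon> / c, (v - d) / c)" using c x by simp
    moreover have "(c * u + \<epsilon>) / c < (v - d) / c" using c x by (intro divide_strict_right_mono) auto
    then have "(\<epsilon> / c, (v - d) / c) \<in> {(\<epsilon>, v). 0 < \<epsilon> \<and> u + \<epsilon> < v}"
      using c x by (simp add: add_divide_distrib)
    ultimately show "x \<in> ?A ` {(\<epsilon>, v). 0 < \<epsilon> \<and> u + \<epsilon> < v}" by blast
  next
    fix x assume "x \<in> ?A ` {(\<epsilon>, v). 0 < \<epsilon> \<and> u + \<epsilon> < v}"
    then obtain \<epsilon> v where x: "x = (c * \<epsilon>, c * v + d)" "0 < \<epsilon>" "u + \<epsilon> < v" by auto
    have "c * (u + \<epsilon>) < c * v" using x c by simp
    then show "x \<in> {(\<epsilon>, v). 0 < \<epsilon> \<and> c * u + d + \<epsilon> < v}"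
      using x c by (simp add: algebra_simps)
  qed
  then show ?thesis
    unfolding multiplicity_infinity_eq[OF \<rho>]
      multiplicity_infinity_eq[OF rank_differences_shrink_affine_reparam[OF \<rho> c]]
    by (simp add: image_image affine_reparam_def case_prod_unfold algebra_simps)
qed

text \<open>
  Here the substitution of \<open>c * \<epsilon>\<close> for \<open>\<epsilon>\<close> suffices.
\<close>

lemma multiplicity_proper_affine_reparam:
  assumes c: "0 < c"
  shows "multiplicity_proper (affine_reparam c d \<rho>) u v = multiplicity_proper \<rho> (c * u + d) (c * v + d)"
proof -
  have "{\<epsilon>. 0 < \<epsilon> \<and> c * u + d + \<epsilon> < c * v + d - \<epsilon>} = (*) c ` {\<epsilon>. 0 < \<epsilon> \<and> u + \<epsilon> < v - \<epsilon>}"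
  proof (intro equalityI subsetI)
    fix \<epsilon> assume \<epsilon>: "\<epsilon> \<in> {\<epsilon>. 0 < \<epsilon> \<and> c * u + d + \<epsilon> < c * v + d - \<epsilon>}"
    then have "\<epsilon> = c * (\<epsilon> / c)" "\<epsilon> / c \<in> {\<epsilon>. 0 < \<epsilon> \<and> u + \<epsilon> < v - \<epsilon>}"
      using c by (auto simp: field_simps)
    then show "\<epsilon> \<in> (*) c ` {\<epsilon>. 0 < \<epsilon> \<and> u + \<epsilon> < v - \<epsilon>}" by blast
  next
    fix \<epsilon> assume "\<epsilon> \<in> (*) c ` {\<epsilon>. 0 < \<epsilon> \<and> u + \<epsilon> < v - \<epsilon>}"
    then obtain \<delta> where "\<epsilon> = c * \<delta>" "0 < \<delta>" "u + \<delta> < v - \<delta>" by auto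
    moreover from this have "c * (u + \<delta>) < c * (v - \<delta>)" using c by simp
    ultimately show "\<epsilon> \<in> {\<epsilon>. 0 < \<epsilon> \<and> c * u + d + \<epsilon> < c * v + d - \<epsilon>}"
      using c by (simp add: algebra_simps)
  qed
  then show ?thesis
    unfolding multiplicity_proper_def by (simp add: image_image affine_reparam_def algebra_simps)
qed

definition affine_point :: "real \<Rightarrow> real \<Rightarrow> (real \<times> ereal) \<times> nat \<Rightarrow> (real \<times> ereal) \<times> nat" where
  "affine_point c d = (\<lambda>((u, v), i). ((c * u + d, ereal c * v + ereal d), i))"

lemma affine_point_inverse:
  assumes "0 < c"
  shows "affine_point (1 / c) (- (d / c)) (affine_point c d p) = p"
    and "affine_point c d (affine_point (1 / c) (- (d / c)) p) = p"
proof -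
  obtain u v i where p: "p = ((u, v), i)" by (metis prod.collapse)
  show "affine_point (1 / c) (- (d / c)) (affine_point c d p) = p"
    and "affine_point c d (affine_point (1 / c) (- (d / c)) p) = p"
    unfolding p by (cases v; use assms in \<open>simp add: affine_point_def field_simps\<close>)+
qed

lemma affine_point_in_persistence_diagram:
  assumes \<rho>: "rank_differences_shrink \<rho>" and c: "0 < c"
  shows "affine_point c d p \<in> persistence_diagram \<rho> \<longleftrightarrow>
     p \<in> persistence_diagram (affine_reparam c d \<rho>)"
proof -
  obtain u v i where p: "p = ((u, v), i)" by (metis prod.collapse)
  show ?thesis
    unfolding p by (cases v; use c in \<open>simp add: affine_point_def persistence_diagram_def
        multiplicity_infinity_affine_reparam[OF \<rho> c] multiplicity_proper_affine_reparam[OF c]\<close>)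
qed

lemma point_dist_affine_point:
  assumes c: "0 < c"
  shows "point_dist (fst (affine_point c d p)) (fst (affine_point c d q)) = ereal c * point_dist (fst p) (fst q)"
proof -
  obtain u v i where p: "p = ((u, v), i)" by (metis prod.collapse)
  obtain u' v' i' where q: "q = ((u', v'), i')" by (metis prod.collapse)
  have mono: "mono ((*) (ereal c))"
    using c by (intro monoI ereal_mult_left_mono) auto
  have 1: "ereal \<bar>c * u + d - (c * u' + d)\<bar> = ereal c * ereal \<bar>u - u'\<bar>"
    using c by (simp add: abs_mult flip: right_diff_distrib)
  have 2: "ext_dist (ereal c * v + ereal d) (ereal c * v' + ereal d) = ereal c * ext_dist v v'"
    using c by (cases v; cases v') (simp_all add: ext_dist_def abs_mult flip: right_diff_distrib)
  have 3: "(ereal c * w + ereal d - ereal (c * x + d)) / 2 = ereal c * ((w - ereal x) / 2)" for w x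
    using c by (cases w) (simp_all add: field_simps)
  show ?thesis
    unfolding p q point_dist_def affine_point_def
    by (simp only: prod.case fst_conv 1 2 3 max_of_mono[OF mono] min_of_mono[OF mono])
qed

text \<open>
  A bijection \<open>\<gamma>\<close> between the diagrams of \<open>\<rho>\<close> and \<open>\<sigma>\<close> is conjugated by the affine map into one between
  those of \<open>\<rho>'\<close> and \<open>\<sigma>'\<close>, whose cost is that of \<open>\<gamma>\<close> divided by \<open>c\<close>.
\<close>

lemma d_match_affine_le:
  assumes c: "0 < c"
    and \<rho>: "\<And>p. affine_point c d p \<in> persistence_diagram \<rho> \<longleftrightarrow> p \<in> persistence_diagram \<rho>'"
    and \<sigma>: "\<And>p. affine_point c d p \<in> persistence_diagram \<sigma> \<longleftrightarrow> p \<in> persistence_diagram \<sigma>'"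
  shows "ereal c * d_match \<rho>' \<sigma>' \<le> d_match \<rho> \<sigma>"
  unfolding d_match_def[of \<rho> \<sigma>]
proof (rule INF_greatest)
  fix \<gamma> assume "\<gamma> \<in> {\<gamma>. bij_betw \<gamma> (persistence_diagram \<rho>) (persistence_diagram \<sigma>)}"
  then have \<gamma>: "bij_betw \<gamma> (persistence_diagram \<rho>) (persistence_diagram \<sigma>)" by simp
  let ?A = "affine_point c d" and ?B = "affine_point (1 / c) (- (d / c))"
  note inverse = affine_point_inverse[OF c, of d]
  have A: "bij_betw ?A (persistence_diagram \<rho>') (persistence_diagram \<rho>)"
    by (rule bij_betw_byWitness[where f' = ?B]) (use \<rho> inverse in \<open>auto simp flip: \<rho>\<close>)
  have B: "bij_betw ?B (persistence_diagram \<sigma>) (persistence_diagram \<sigma>')"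
    by (rule bij_betw_byWitness[where f' = ?A]) (use \<sigma> inverse in \<open>auto simp flip: \<sigma>\<close>)
  have bij: "bij_betw (?B \<circ> (\<gamma> \<circ> ?A)) (persistence_diagram \<rho>') (persistence_diagram \<sigma>')"
    using bij_betw_trans[OF bij_betw_trans[OF A \<gamma>] B] .
  have dist: "ereal c * point_dist (fst p) (fst (?B q)) = point_dist (fst (?A p)) (fst q)" for p q
    using point_dist_affine_point[OF c, of d p "?B q"] unfolding inverse(2) by (rule sym)
  have ne: "persistence_diagram \<rho>' \<noteq> {}"
    by (auto simp: persistence_diagram_def)
  have "d_match \<rho>' \<sigma>' \<le> (SUP p\<in>persistence_diagram \<rho>'. point_dist (fst p) (fst ((?B \<circ> (\<gamma> \<circ> ?A)) p)))"
    unfolding d_match_def by (rule INF_lower, rule CollectI, rule bij)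
  then have "ereal c * d_match \<rho>' \<sigma>' \<le>
      ereal c * (SUP p\<in>persistence_diagram \<rho>'. point_dist (fst p) (fst ((?B \<circ> (\<gamma> \<circ> ?A)) p)))"
    using c by (intro ereal_mult_left_mono) auto
  also have "\<dots> = (SUP p\<in>persistence_diagram \<rho>'. ereal c * point_dist (fst p) (fst ((?B \<circ> (\<gamma> \<circ> ?A)) p)))"
    using c by (intro Sup_ereal_mult_left' ne) simp
  also have "\<dots> = (SUP p\<in>persistence_diagram \<rho>'. point_dist (fst (?A p)) (fst (\<gamma> (?A p))))"
    by (simp add: dist)
  also have "\<dots> = (SUP p\<in>?A ` persistence_diagram \<rho>'. point_dist (fst p) (fst (\<gamma> p)))"
    by (simp add: image_image)
  also have "?A ` persistence_diagram \<rho>' = persistence_diagram \<rho>"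
    using A by (simp add: bij_betw_def)
  finally show "ereal c * d_match \<rho>' \<sigma>' \<le> (SUP p\<in>persistence_diagram \<rho>. point_dist (fst p) (fst (\<gamma> p)))" .
qed

text \<open>
  The reverse inequality is the same one for the inverse affine map.
\<close>

lemma d_match_affine_reparam:
  assumes \<rho>: "rank_differences_shrink \<rho>" and \<sigma>: "rank_differences_shrink \<sigma>" and c: "0 < c"
  shows "ereal c * d_match (affine_reparam c d \<rho>) (affine_reparam c d \<sigma>) = d_match \<rho> \<sigma>"
proof (rule antisym)
  let ?\<rho>' = "affine_reparam c d \<rho>" and ?\<sigma>' = "affine_reparam c d \<sigma>"
  note A = affine_point_in_persistence_diagram[OF _ c, of _ d]
  show "ereal c * d_match ?\<rho>' ?\<sigma>' \<le> d_match \<rho> \<sigma>"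
    by (rule d_match_affine_le[OF c A[OF \<rho>] A[OF \<sigma>]])
  have "affine_point (1 / c) (- (d / c)) p \<in> persistence_diagram (affine_reparam c d \<tau>) \<longleftrightarrow>
      p \<in> persistence_diagram \<tau>" if "rank_differences_shrink \<tau>" for \<tau> p
    using A[OF that, of "affine_point (1 / c) (- (d / c)) p"]
    unfolding affine_point_inverse(2)[OF c] by (rule sym)
  then have "ereal (1 / c) * d_match \<rho> \<sigma> \<le> d_match ?\<rho>' ?\<sigma>'"
    using c \<rho> \<sigma> by (intro d_match_affine_le) auto
  then have "ereal c * (ereal (1 / c) * d_match \<rho> \<sigma>) \<le> ereal c * d_match ?\<rho>' ?\<sigma>'"
    using c by (intro ereal_mult_left_mono) auto
  then show "d_match \<rho> \<sigma> \<le> ereal c * d_match ?\<rho>' ?\<sigma>'"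
    using c by (simp flip: mult.assoc)
qed

section \<open>Half-planes and their parameters\<close>

lemma continuous_map_sublevel:
  fixes u v :: "'b::order"
  assumes "u \<le> v"
  shows "continuous_map (sublevel X \<phi> u) (sublevel X \<phi> v) (\<lambda>x. x)"
  using assms unfolding sublevel_def
  by (auto simp: continuous_map_in_subtopology intro: continuous_map_from_subtopology)

lemma rank_invariant_eq_inclusion_rank:
  "rank_invariant F k X \<phi> u v = inclusion_rank F k (sublevel X \<phi> u) (sublevel X \<phi> v)"
  by (simp add: rank_invariant_def inclusion_rank_def)

lemma rank_differences_shrink_rank_invariant:
  fixes \<phi> :: "'a \<Rightarrow> real"
  shows "rank_differences_shrink (rank_invariant TYPE('f::field) k X \<phi>)"
  unfolding rank_differences_shrink_def
proof (intro allI impI)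
  fix u1 u1' u2' u2 v v' :: real
  assume le: "u1 \<le> u1'" "u1' \<le> u2'" "u2' \<le> u2" "u2 \<le> v" "v \<le> v'"
  let ?\<rho> = "\<lambda>u v. ereal_of_enat (rank_invariant TYPE('f) k X \<phi> u v)"
  have mono: "?\<rho> u w \<le> ?\<rho> u' w" if "u \<le> u'" "u' \<le> w" for u u' w
    using inclusion_rank_mono[OF continuous_map_sublevel[OF that(1)] continuous_map_sublevel[OF that(2)]]
    by (simp add: rank_invariant_eq_inclusion_rank)
  have "?\<rho> u2' v' - ?\<rho> u1' v' \<le> ?\<rho> u2 v' - ?\<rho> u1 v'"
    using le by (intro ereal_minus_mono mono) auto
  also have "\<dots> \<le> ?\<rho> u2 v - ?\<rho> u1 v"
    unfolding rank_invariant_eq_inclusion_rank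
    using le by (intro inclusion_rank_diff_antimono continuous_map_sublevel) auto
  finally show "?\<rho> u2' v' - ?\<rho> u1' v' \<le> ?\<rho> u2 v - ?\<rho> u1 v" .
qed

lemma reduced_filtering_le_iff:
  "reduced_filtering \<phi> l b x \<le> u \<longleftrightarrow> (\<forall>i. (\<phi> x $ i - b $ i) / l $ i \<le> u)"
  unfolding reduced_filtering_def by (subst Max_le_iff) auto

text \<open>
  The reduced filtering function for the new parameters is \<open>(F - d) / c\<close>, where \<open>F\<close> is the one for
  \<open>l\<close> and \<open>b\<close>; so its sublevel sets are those of \<open>F\<close> at the levels \<open>c * u + d\<close>.
\<close>

lemma rank_invariant_rescaled_parameters:
  assumes l: "\<And>i. 0 < l $ i" and c: "0 < c"
  shows "rank_invariant F k X (reduced_filtering \<phi> (c *\<^sub>R l) (b + d *\<^sub>R l)) =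
     affine_reparam c d (rank_invariant F k X (reduced_filtering \<phi> l b))"
proof -
  have "reduced_filtering \<phi> (c *\<^sub>R l) (b + d *\<^sub>R l) x \<le> u \<longleftrightarrow> reduced_filtering \<phi> l b x \<le> c * u + d" for x u
    unfolding reduced_filtering_le_iff
    using c l by (simp add: pos_divide_le_eq algebra_simps)
  then have "sublevel X (reduced_filtering \<phi> (c *\<^sub>R l) (b + d *\<^sub>R l)) u =
      sublevel X (reduced_filtering \<phi> l b) (c * u + d)" for u
    by (simp add: sublevel_def)
  then show ?thesis
    by (simp add: fun_eq_iff rank_invariant_eq_inclusion_rank affine_reparam_def)
qed

lemma Min_scaleR:
  fixes l :: "real ^ 'n"
  assumes "0 < c"
  shows "(MIN i. (c *\<^sub>R l) $ i) = c * (MIN i. l $ i)"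
proof -
  have "mono ((*) c)" using assms by (intro monoI) simp
  then show ?thesis
    using mono_Min_commute[of "(*) c" "range (($) l)"] by (simp add: image_image)
qed

text \<open>
  The weight is multiplied by \<open>c\<close> and the matching distance divided by it.
\<close>

lemma weighted_d_match_rescaled_parameters:
  fixes \<phi> :: "'a \<Rightarrow> real ^ 'n" and \<psi> :: "'b \<Rightarrow> real ^ 'n"
  assumes l: "\<And>i. 0 < l $ i" and c: "0 < c"
  shows "ereal (MIN i. (c *\<^sub>R l) $ i) *
       d_match (rank_invariant TYPE('f::field) k X (reduced_filtering \<phi> (c *\<^sub>R l) (b + d *\<^sub>R l)))
               (rank_invariant TYPE('f) k Y (reduced_filtering \<psi> (c *\<^sub>R l) (b + d *\<^sub>R l))) =
     ereal (MIN i. l $ i) *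
       d_match (rank_invariant TYPE('f) k X (reduced_filtering \<phi> l b))
               (rank_invariant TYPE('f) k Y (reduced_filtering \<psi> l b))"
proof -
  have "ereal (MIN i. (c *\<^sub>R l) $ i) = ereal (MIN i. l $ i) * ereal c"
    by (simp only: Min_scaleR[OF c]) (simp add: mult.commute)
  then show ?thesis
    by (simp only: rank_invariant_rescaled_parameters[OF l c] mult.assoc
        d_match_affine_reparam[OF rank_differences_shrink_rank_invariant
          rank_differences_shrink_rank_invariant c])
qed

lemma half_plane_direction_pos:
  assumes "half_plane l b \<subseteq> Delta_plus"
  shows "0 < l $ i"
proof -
  have "(0 *\<^sub>R l + b, 1 *\<^sub>R l + b) \<in> half_plane l b"
    unfolding half_plane_def by (rule CollectI, intro exI conjI) (rule refl, simp)
  then have "(b, l + b) \<in> Delta_plus" using assms by auto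
  then show ?thesis by (simp add: Delta_plus_def)
qed

text \<open>
  Dividing \<open>l\<close> by its norm and moving \<open>b\<close> along \<open>l\<close> until its coordinates sum to zero; the latter is
  possible since the coordinates of \<open>l\<close> have a positive sum.
\<close>

lemma admissible_parameters_exist:
  fixes l b :: "real ^ 'n"
  assumes l: "\<And>i. 0 < l $ i"
  obtains c d where "0 < c" "(c *\<^sub>R l, b + d *\<^sub>R l) \<in> Adm"
proof
  let ?N = "\<Sum>i\<in>UNIV. (l $ i)\<^sup>2" and ?d = "- (\<Sum>i\<in>UNIV. b $ i) / (\<Sum>i\<in>UNIV. l $ i)"
  have "l $ i \<noteq> 0" for i using l[of i] by simp
  then have N: "0 < ?N" and S: "0 < (\<Sum>i\<in>UNIV. l $ i)"
    using l by (auto intro!: sum_pos)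
  show "0 < 1 / sqrt ?N" using N by simp
  have "(\<Sum>i\<in>UNIV. (((1 / sqrt ?N) *\<^sub>R l) $ i)\<^sup>2) = (1 / sqrt ?N)\<^sup>2 * ?N"
    by (simp only: vector_scaleR_component real_scaleR_def power_mult_distrib sum_distrib_left)
  also have "\<dots> = 1" using N by (simp add: power_divide)
  finally have "(\<Sum>i\<in>UNIV. (((1 / sqrt ?N) *\<^sub>R l) $ i)\<^sup>2) = 1" .
  moreover have "(\<Sum>i\<in>UNIV. (b + ?d *\<^sub>R l) $ i) = (\<Sum>i\<in>UNIV. b $ i) + ?d * (\<Sum>i\<in>UNIV. l $ i)"
    by (simp only: vector_add_component vector_scaleR_component real_scaleR_def sum.distrib sum_distrib_left)
  then have "(\<Sum>i\<in>UNIV. (b + ?d *\<^sub>R l) $ i) = 0"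
    using S by simp
  ultimately show "((1 / sqrt ?N) *\<^sub>R l, b + ?d *\<^sub>R l) \<in> Adm"
    using l \<open>0 < 1 / sqrt ?N\<close> by (simp add: Adm_def)
qed

text \<open>
  If the line in direction \<open>m\<close> through \<open>\<beta>\<close> contains \<open>b\<close> and \<open>l + b\<close>, in this order, then it is the line in
  direction \<open>l\<close> through \<open>b\<close>, with the same orientation.
\<close>

lemma parameters_of_parallel_half_plane:
  assumes "(b, l + b) \<in> half_plane m \<beta>"
  obtains c d where "0 < c" "l = c *\<^sub>R m" "b = \<beta> + d *\<^sub>R m"
proof -
  obtain s t where st: "s < t" "b = s *\<^sub>R m + \<beta>" "l + b = t *\<^sub>R m + \<beta>"
    using assms by (auto simp: half_plane_def)
  show thesis
  proof
    show "0 < t - s" using st(1) by simp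
    show "l = (t - s) *\<^sub>R m" using st(2,3) by (simp add: scaleR_diff_left algebra_simps)
    show "b = \<beta> + s *\<^sub>R m" using st(2) by simp
  qed
qed

theorem theorem2p8:
  fixes X :: "'a topology" and Y :: "'b topology"
    and \<phi> :: "'a \<Rightarrow> real ^ 'n" and \<psi> :: "'b \<Rightarrow> real ^ 'n"
    and \<Lambda> B :: "(real ^ 'n) set"
    and k :: int
  assumes "triangulable TYPE('e1::euclidean_space) X"
    and "triangulable TYPE('e2::euclidean_space) Y"
    and "continuous_map X euclidean \<phi>"
    and "continuous_map Y euclidean \<psi>"
    and "\<forall>(u, v) \<in> Delta_plus. \<exists>!(l, b). (l, b) \<in> \<Lambda> \<times> B \<and> (u, v) \<in> half_plane l b"
    and "\<forall>(l, b) \<in> \<Lambda> \<times> B. half_plane l b \<subseteq> Delta_plus"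
  shows "D_match_hat TYPE('f::field) k \<Lambda> B X \<phi> Y \<psi> = D_match TYPE('f) k X \<phi> Y \<psi>"
proof -
  let ?val = "\<lambda>(l, b). ereal (MIN i. l $ i) *
        d_match (rank_invariant TYPE('f) k X (reduced_filtering \<phi> l b))
                (rank_invariant TYPE('f) k Y (reduced_filtering \<psi> l b))"
  have pos: "0 < l $ i" if "(l, b) \<in> \<Lambda> \<times> B" for l b i
    using assms(6) that by (intro half_plane_direction_pos[of l b]) blast
  have val: "?val (c *\<^sub>R l, b + d *\<^sub>R l) = ?val (l, b)" if "(l, b) \<in> \<Lambda> \<times> B" "0 < c" for l b c d
    using weighted_d_match_rescaled_parameters[OF pos[OF that(1)] that(2)] by simp
  have "(SUP p \<in> \<Lambda> \<times> B. ?val p) = (SUP p \<in> Adm. ?val p)"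
  proof (rule SUP_eq)
    fix p assume p: "p \<in> \<Lambda> \<times> B"
    obtain l b where lb: "p = (l, b)" by (cases p)
    obtain c d where "0 < c" "(c *\<^sub>R l, b + d *\<^sub>R l) \<in> Adm"
      using admissible_parameters_exist[of l b] pos[of l b] p lb by blast
    then show "\<exists>q\<in>Adm. ?val p \<le> ?val q"
      using val[of l b c d] p lb by (intro bexI[of _ "(c *\<^sub>R l, b + d *\<^sub>R l)"]) auto
  next
    fix q :: "(real ^ 'n) \<times> (real ^ 'n)" assume q: "q \<in> Adm"
    obtain l b where lb: "q = (l, b)" by (cases q)
    have "(b, l + b) \<in> Delta_plus" using q lb by (simp add: Adm_def Delta_plus_def)
    then obtain m \<beta> where m\<beta>: "(m, \<beta>) \<in> \<Lambda> \<times> B" "(b, l + b) \<in> half_plane m \<beta>"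
      using assms(5) by blast
    obtain c d where cd: "0 < c" "l = c *\<^sub>R m" "b = \<beta> + d *\<^sub>R m"
      using parameters_of_parallel_half_plane[OF m\<beta>(2)] .
    show "\<exists>p\<in>\<Lambda> \<times> B. ?val q \<le> ?val p"
      using val[OF m\<beta>(1) cd(1), of d] m\<beta>(1) cd lb by (intro bexI[of _ "(m, \<beta>)"]) auto
  qed
  then show ?thesis by (simp add: D_match_hat_def D_match_def)
qed

end
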